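(* Let $\lambda=(\lambda_1,\dots,\lambda_k)$ be a partition of $n$ and let $K_\lambda(n)$ be the multistar of type $\lambda$. Let $F_\lambda(n)$ be the number of faces of a uniformly random orientable 2-cell embedding of $K_\lambda(n)$. Let $r(\lambda)$ be the number of parts of $\lambda$ equal to $1$, and let $n'=n-r(\lambda)$, where it is assumed that $\lambda$ has at least one part of size at least $2$, so that $n'\ge 2$. Then $$\mathbb{E}(F_\lambda(n))\in\left(\Delta_{n'}-\tfrac{1}{n'+1},\ \Delta_{n'}+\tfrac{1}{n'+1}\right),\qquad\text{where } \Delta_{n'}=H_{n'-1}+\left\lceil \tfrac{n'}{2}\right\rceil^{-1}.$$
   Context: The multistar $K_\lambda(n)$ is the loopless multigraph with a center vertex $v_0$ and outer vertices $v_1,\dots,v_k$, where $v_0$ and $v_i$ are joined by $\lambda_i$ parallel edges ($1\le i\le k$) and there are no other edges. Orientable 2-cell embeddings are identified with rotation systems: for each vertex $v$ a cyclic permutation $\pi_v$ of the darts (half-edges) at $v$. A uniformly random embedding chooses each $\pi_v$ independently and uniformly. The faces are the orbits of the face permutation $\sigma\cdot\prod_v\pi_v$, where $\sigma$ is the involution exchanging the two darts of each edge. $H_m=1+\tfrac12+\cdots+\tfrac1m$ is the $m$-th harmonic number, with $H_0=0$. *)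

theory Defs
  imports
    "HOL-Probability.Product_PMF"
    "HOL-Combinatorics.Orbits"
    "HOL-Analysis.Harmonic_Numbers"
begin

definition number_partition :: "nat list \<Rightarrow> nat \<Rightarrow> bool" where
  "number_partition lam n \<longleftrightarrow>
     sorted_wrt (\<ge>) lam \<and> (\<forall>x\<in>set lam. 0 < x) \<and> sum_list lam = n"

text \<open>
  Edges are undirected: the order of the two endpoints given by \<open>ends\<close> only serves to name the
  two darts of an edge \<open>e\<close>, namely \<open>(e, False)\<close> at the first and \<open>(e, True)\<close> at the second
  endpoint.
\<close>

record ('v, 'e) multigraph =
  verts :: "'v set"
  edges :: "'e set"
  ends :: "'e \<Rightarrow> 'v \<times> 'v"

type_synonym 'e dart = "'e \<times> bool"

definition darts :: "('v, 'e) multigraph \<Rightarrow> 'e dart set" where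
  "darts G = edges G \<times> UNIV"

definition dart_vertex :: "('v, 'e) multigraph \<Rightarrow> 'e dart \<Rightarrow> 'v" where
  "dart_vertex G d = (if snd d then snd (ends G (fst d)) else fst (ends G (fst d)))"

definition darts_at :: "('v, 'e) multigraph \<Rightarrow> 'v \<Rightarrow> 'e dart set" where
  "darts_at G v = {d \<in> darts G. dart_vertex G d = v}"

definition dart_rev :: "'e dart \<Rightarrow> 'e dart" where
  "dart_rev d = (fst d, \<not> snd d)"

definition cyclic_perms :: "'a set \<Rightarrow> ('a \<Rightarrow> 'a) set" where
  "cyclic_perms S = {p. p permutes S \<and> cyclic_on p S}"

text \<open>
  A rotation system assigns to every vertex a cyclic permutation of the darts at that vertex.
  The distribution below is meaningful for finite multigraphs without isolated vertices, since
  \<^term>\<open>cyclic_perms {}\<close> is empty.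
\<close>

definition random_embedding :: "('v, 'e) multigraph \<Rightarrow> ('v \<Rightarrow> 'e dart \<Rightarrow> 'e dart) pmf" where
  "random_embedding G =
     Pi_pmf (verts G) id (\<lambda>v. pmf_of_set (cyclic_perms (darts_at G v)))"

text \<open>
  The permutations at the vertices have disjoint supports, so their product maps a dart \<open>d\<close> at
  the vertex \<open>v\<close> to \<open>\<pi> v d\<close>.
\<close>

definition face_perm ::
  "('v, 'e) multigraph \<Rightarrow> ('v \<Rightarrow> 'e dart \<Rightarrow> 'e dart) \<Rightarrow> 'e dart \<Rightarrow> 'e dart" where
  "face_perm G \<pi> d = (if d \<in> darts G then dart_rev (\<pi> (dart_vertex G d) d) else d)"

definition faces ::
  "('v, 'e) multigraph \<Rightarrow> ('v \<Rightarrow> 'e dart \<Rightarrow> 'e dart) \<Rightarrow> 'e dart set set" where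
  "faces G \<pi> = orbit (face_perm G \<pi>) ` darts G"

definition expected_faces :: "('v, 'e) multigraph \<Rightarrow> real" where
  "expected_faces G = measure_pmf.expectation (random_embedding G) (\<lambda>\<pi>. real (card (faces G \<pi>)))"

datatype star_vertex = Center | Outer nat

text \<open>The edge \<open>(i, j)\<close> is the \<open>j\<close>-th of the parallel edges between \<open>Center\<close> and \<open>Outer i\<close>.\<close>

definition multistar :: "nat list \<Rightarrow> (star_vertex, nat \<times> nat) multigraph" where
  "multistar lam =
     \<lparr> verts = insert Center (Outer ` {..<length lam}),
       edges = (SIGMA i:{..<length lam}. {..<lam ! i}),
       ends = (\<lambda>(i, j). (Center, Outer i)) \<rparr>"

definition Delta :: "nat \<Rightarrow> real" where
  "Delta m = harm (m - 1) + inverse (real_of_int \<lceil>real m / 2\<rceil>)"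

end

theory Submission
  imports Defs
begin

text \<open>
  Moving the rotations at the outer vertices to the darts at the center turns the number of faces
  into the number of cycles of \<open>p \<circ> c\<close>, where \<open>p\<close> is a permutation of cycle type
  \<open>lam\<close> and \<open>c\<close> is a uniformly random long cycle. Its expectation is
  \<open>\<integral> (1 - (1 - t) * F t) / t\<close> over \<open>[0, 1]\<close>, where \<open>F\<close> is the product over
  the parts \<open>l\<close> of \<open>(1 - t)^l - (- t)^l\<close>. This is proved by induction: deleting one point
  \<open>n\<close> from \<open>c\<close> replaces \<open>p\<close> by \<open>p\<close> with \<open>n\<close> deleted and composed with a
  random transposition, which cuts a cycle or joins two, and the corresponding identity between the
  polynomials \<open>F\<close> holds up to a total derivative.

  Parts of size 1 contribute the factor 1 to \<open>F\<close>. If the other parts have sum \<open>m\<close>, then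
  \<open>F\<close> is \<open>(1 - t)^m \<plusminus> t^m\<close> up to terms of absolute value at most
  \<open>c * (1 - t)^2 * t^2 * ((1 - t)^2 + t^2)^j\<close> with \<open>j = m div 2 - 2\<close> and \<open>c \<le> j + 2\<close>.
  The two extreme terms give \<open>Delta m\<close> up to \<open>2 / (m * (m + 1))\<close>, and the integral of the
  remaining ones is controlled by the moments of \<open>(1 - t)^2 + t^2\<close>.
\<close>

hide_const (open) Finite_Cartesian_Product.transpose

section \<open>Orbits of permutations under deletion and transposition\<close>

lemma orbit_eq_of_mem:
  assumes "permutation p" "y \<in> orbit p x"
  shows "orbit p y = orbit p x"
  using orbit_cyclic_eq3[OF cyclic_on_orbit'[OF assms(1)] assms(2)] .

lemma orbit_subset_of_closed:
  assumes "p x \<in> S" "\<And>y. y \<in> S \<Longrightarrow> p y \<in> S"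
  shows "orbit p x \<subseteq> S"
proof
  fix y assume "y \<in> orbit p x"
  then show "y \<in> S" by induct (use assms in auto)
qed

text \<open>The transposition makes \<open>n\<close> a fixed point and sends its former predecessor
  straight to \<open>s n\<close>, so the other points are traversed as before with the visit to
  \<open>n\<close> skipped.\<close>

lemma orbit_delete:
  assumes s: "permutation s" and x: "x \<noteq> n"
  shows "orbit (transpose n (s n) \<circ> s) x = orbit s x - {n}" (is "orbit ?s' x = _")
proof -
  have inj: "s u = s v \<longleftrightarrow> u = v" for u v
    using s by (simp add: permutation_bijective bij_is_inj inj_eq)
  have stp: "?s' y = (if s y = n then s n else s y)" if "y \<noteq> n" for y
    using that inj by (auto simp: Transposition.transpose_def)
  have ne: "?s' y \<noteq> n" if "y \<noteq> n" for y
    using that inj by (auto simp: Transposition.transpose_def)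
  have mem: "?s' y \<in> orbit s x - {n}" if "y = x \<or> y \<in> orbit s x" "y \<noteq> n" for y
  proof -
    have "s y \<in> orbit s x" using that by (auto intro: orbit.intros)
    moreover from this have "s (s y) \<in> orbit s x" by (rule orbit.step)
    ultimately show ?thesis using stp[OF that(2)] ne[OF that(2)] by auto
  qed
  have "orbit ?s' x \<subseteq> orbit s x - {n}"
    by (rule orbit_subset_of_closed) (use mem x in blast)+
  \<comment> \<open>The second conjunct carries the induction past \<open>n\<close>: when the orbit
    of \<open>s\<close> arrives at \<open>n\<close>, the shortened orbit already contains
    \<open>s n\<close>.\<close>
  moreover have "(y \<noteq> n \<longrightarrow> y \<in> orbit ?s' x) \<and> (y = n \<longrightarrow> s n \<noteq> n \<longrightarrow> s n \<in> orbit ?s' x)"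
    if "y \<in> orbit s x" for y
    using that
  proof induct
    case base
    then show ?case using orbit.base[of ?s' x] stp[OF x] inj x by (metis)
  next
    case (step y)
    show ?case
    proof (cases "y = n")
      case True
      then show ?thesis using step inj by auto
    next
      case False
      then have "?s' y \<in> orbit ?s' x" using step orbit.step[of y ?s' x] by blast
      then show ?thesis
        using stp[OF False] by metis
    qed
  qed
  ultimately show ?thesis by blast
qed

lemma delete_permutes:
  assumes "s permutes insert n A" "n \<notin> A"
  shows "transpose n (s n) \<circ> s permutes A"
proof (cases "s n = n")
  case True
  then show ?thesis using assms
    by (auto intro!: permutes_superset[OF assms(1)])
next
  case False
  have "transpose n (s n) \<circ> s permutes insert n A"
    using assms permutes_in_image[OF assms(1)]
    by (intro permutes_compose[OF assms(1)] permutes_swap_id) auto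
  then show ?thesis
    by (rule permutes_superset) (use assms in auto)
qed

text \<open>Only the cycle through \<open>n\<close> changes. It survives the deletion as
  \<open>C\<close> because \<open>s n\<close> differs from \<open>n\<close>.\<close>

lemma orbits_delete:
  assumes s: "s permutes insert n A" and A: "finite A" "n \<notin> A" and ne: "s n \<noteq> n"
  defines "s' \<equiv> transpose n (s n) \<circ> s"
  defines "C \<equiv> orbit s' (s n)"
  shows "orbit s ` insert n A = insert (insert n C) (orbit s' ` A - {C})"
proof -
  have perm: "permutation s" using s A by (auto simp: permutation_permutes)
  have mem: "x \<in> orbit s x" for x using perm by (rule permutation_self_in_orbit)
  have b: "s n \<in> A" using permutes_in_image[OF s, of n] ne by auto
  have del: "orbit s' x = orbit s x - {n}" if "x \<noteq> n" for x
    unfolding s'_def using orbit_delete[OF perm that] .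
  have eq: "orbit s y = orbit s x" if "y \<in> orbit s x" for x y
    using orbit_eq_of_mem[OF perm that] .
  have C: "insert n C = orbit s n"
    unfolding C_def del[OF ne] permutation_orbit_step[OF perm] using mem[of n] by blast
  have D: "n \<notin> orbit s x \<longleftrightarrow> orbit s' x \<noteq> C" if "x \<in> A" for x
  proof -
    have xn: "x \<noteq> n" using that A by blast
    show ?thesis
    proof
      assume "n \<notin> orbit s x"
      then show "orbit s' x \<noteq> C"
        using C del[OF xn] mem[of x] eq mem[of n] xn by blast
    next
      assume "orbit s' x \<noteq> C"
      then show "n \<notin> orbit s x"
        using C del[OF xn] del[OF ne] eq permutation_orbit_step[OF perm]
        unfolding C_def by metis
    qed
  qed
  have "orbit s ` A = {orbit s x | x. x \<in> A \<and> n \<in> orbit s x} \<union> {orbit s x | x. x \<in> A \<and> n \<notin> orbit s x}"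
    by blast
  moreover have "{orbit s x | x. x \<in> A \<and> n \<in> orbit s x} = {insert n C}"
  proof -
    have "orbit s x = insert n C" if "n \<in> orbit s x" for x
      unfolding C using eq[OF that] by simp
    moreover have "n \<in> orbit s (s n)"
      using mem[of n] permutation_orbit_step[OF perm] by simp
    ultimately show ?thesis using b by blast
  qed
  moreover have "{orbit s x | x. x \<in> A \<and> n \<notin> orbit s x} = orbit s' ` A - {C}"
  proof -
    have "orbit s x = orbit s' x" if "x \<in> A" "n \<notin> orbit s x" for x
      using that del[of x] A by auto
    then have "{orbit s x | x. x \<in> A \<and> n \<notin> orbit s x} = {orbit s' x | x. x \<in> A \<and> n \<notin> orbit s x}"
      by (intro Collect_cong ex_cong1) auto
    also have "\<dots> = {orbit s' x | x. x \<in> A \<and> orbit s' x \<noteq> C}"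
      using D by (intro Collect_cong ex_cong1) auto
    finally show ?thesis by auto
  qed
  ultimately show ?thesis using C by auto
qed

text \<open>\<open>U\<close> is a union of cycles of \<open>p\<close> that contains both transposed
  points. A point outside \<open>U\<close> never reaches \<open>b\<close> or \<open>i\<close>, so
  the transposition does not affect its orbit.\<close>

lemma orbits_transpose_outside:
  assumes p: "p permutes A" "finite A" and U: "b \<in> U" "i \<in> U"
    and cl: "\<And>x. x \<in> U \<Longrightarrow> orbit p x \<subseteq> U" and UA: "U \<subseteq> A"
  defines "q \<equiv> transpose b i \<circ> p"
  shows "orbit q ` A = orbit q ` U \<union> (orbit p ` A - orbit p ` U)"
proof -
  have perm: "permutation p" using p by (auto simp: permutation_permutes)
  have mem: "x \<in> orbit p x" for x using perm by (rule permutation_self_in_orbit)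
  have eq: "orbit p y = orbit p x" if "y \<in> orbit p x" for x y
    using orbit_eq_of_mem[OF perm that] .
  have out: "orbit q x = orbit p x" if "x \<notin> U" for x
  proof (rule orbit_cong[OF mem])
    fix s assume "s \<in> orbit p x"
    then have "p s \<in> orbit p x" by (rule orbit.step)
    then have "p s \<noteq> b" "p s \<noteq> i" using U eq cl mem that by blast+
    then show "q s = p s" by (simp add: q_def)
  qed
  have "orbit p ` A - orbit p ` U = orbit p ` (A - U)"
    using eq mem cl by blast
  moreover have "orbit q ` A = orbit q ` U \<union> orbit q ` (A - U)" using UA by blast
  ultimately show ?thesis using out by auto
qed

text \<open>Starting from \<open>b\<close>, the step that would close the cycle of \<open>b\<close>
  now leads to \<open>i\<close>, and the step that would close the cycle of \<open>i\<close> leads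
  back to \<open>b\<close>.\<close>

lemma orbits_join:
  assumes p: "p permutes A" "finite A" and b: "b \<in> A" and i: "i \<in> A" "i \<notin> orbit p b"
  shows "orbit (transpose b i \<circ> p) ` A
    = insert (orbit p b \<union> orbit p i) (orbit p ` A - {orbit p b, orbit p i})"
proof -
  define q where "q = transpose b i \<circ> p"
  define U where "U = orbit p b \<union> orbit p i"
  have perm: "permutation p" using p by (auto simp: permutation_permutes)
  have permq: "permutation q"
    unfolding q_def by (intro permutation_compose perm permutation_swap_id)
  have mem: "x \<in> orbit p x" for x using perm by (rule permutation_self_in_orbit)
  have eq: "orbit p y = orbit p x" if "y \<in> orbit p x" for x y
    using orbit_eq_of_mem[OF perm that] .
  have memq: "x \<in> orbit q x" for x using permq by (rule permutation_self_in_orbit)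
  have eqq: "orbit q y = orbit q x" if "y \<in> orbit q x" for x y
    using orbit_eq_of_mem[OF permq that] .
  \<comment> \<open>Stated for both orders of the two points, so that one argument covers both
    halves of the merged cycle.\<close>
  have sub: "orbit p a \<subseteq> orbit q a \<and> c \<in> orbit q a"
    if "(a, c) = (b, i) \<or> (a, c) = (i, b)" for a c
  proof -
    have ac: "c \<notin> orbit p a" "q = transpose a c \<circ> p"
      using that i eq mem unfolding q_def by (auto simp: transpose_commute)
    define l where "l = funpow_dist1 p a a"
    have l: "orbit p a = (\<lambda>n. (p ^^ n) a) ` {0..<l}" "(p ^^ l) a = a" "0 < l"
      unfolding l_def using orbit_conv_funpow_dist1[OF mem] funpow_dist1_prop[OF mem] by auto
    have ne: "(p ^^ n) a \<noteq> a" if "0 < n" "n < l" for n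
      using that unfolding l_def by (rule funpow_dist1_least)
    have pin: "(p ^^ n) a \<in> orbit q a" if "n < l" for n
      using that
    proof (induct n)
      case 0
      then show ?case using memq by simp
    next
      case (Suc n)
      have "p ((p ^^ n) a) \<noteq> a" using ne[of "Suc n"] Suc by simp
      moreover have "p ((p ^^ n) a) \<noteq> c"
        using ac funpow_in_orbit[OF mem, of "Suc n" a] by auto
      ultimately have "q ((p ^^ n) a) = (p ^^ Suc n) a" by (simp add: ac)
      then show ?case using Suc orbit.step[of "(p ^^ n) a" q a] by simp
    qed
    \<comment> \<open>The last point of the cycle before its return to \<open>a\<close> is
      redirected to \<open>c\<close>.\<close>
    have "q ((p ^^ (l - 1)) a) = c"
    proof -
      have "p ((p ^^ (l - 1)) a) = (p ^^ Suc (l - 1)) a" by simp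
      then show ?thesis using l by (simp add: ac del: funpow.simps)
    qed
    then have "c \<in> orbit q a"
      using orbit.step[OF pin[of "l - 1"]] l(3) by auto
    then show ?thesis using pin l by auto
  qed
  have "orbit q i = orbit q b" using sub[of b i] eqq by auto
  then have 1: "U \<subseteq> orbit q b" using sub[of b i] sub[of i b] unfolding U_def by auto
  have cl: "p x \<in> U" "q x \<in> U" if "x \<in> U" for x
  proof -
    show "p x \<in> U" using that unfolding U_def by (auto intro: orbit.step)
    then show "q x \<in> U" using mem unfolding q_def U_def by (auto simp: Transposition.transpose_def)
  qed
  have bU: "b \<in> U" "i \<in> U" unfolding U_def using mem by auto
  have "orbit q b \<subseteq> U"
    by (rule orbit_subset_of_closed) (use cl bU in auto)
  with 1 have qb: "orbit q b = U" by auto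
  have qU: "orbit q ` U = {U}"
    using qb eqq bU by auto
  have pU: "orbit p ` U = {orbit p b, orbit p i}"
    unfolding U_def using eq mem by auto
  have "orbit q ` A = orbit q ` U \<union> (orbit p ` A - orbit p ` U)"
    unfolding q_def
  proof (rule orbits_transpose_outside[OF p bU])
    show "orbit p x \<subseteq> U" if "x \<in> U" for x using that eq unfolding U_def by auto
    show "U \<subseteq> A" unfolding U_def using permutes_orbit_subset[OF p(1)] b i by auto
  qed
  then show ?thesis unfolding qU pU unfolding U_def q_def by simp
qed

text \<open>Number the cycle of \<open>b\<close> as \<open>f 0\<close>, ...,
  \<open>f (l - 1)\<close>, with \<open>f c\<close> the other transposed point. The transposition
  redirects \<open>f (c - 1)\<close> to \<open>f 0\<close> and \<open>f (l - 1)\<close> to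
  \<open>f c\<close>, so the index intervals from 0 to \<open>c\<close> and from \<open>c\<close> to
  \<open>l\<close> close up separately.\<close>

lemma orbits_cut:
  assumes p: "p permutes A" "finite A" and b: "b \<in> A"
    and c: "0 < c" "c < card (orbit p b)"
  obtains C1 C2 where "orbit (transpose b ((p ^^ c) b) \<circ> p) ` A
      = insert C1 (insert C2 (orbit p ` A - {orbit p b}))"
    "C1 \<union> C2 = orbit p b" "C1 \<inter> C2 = {}" "card C1 = c" "card C2 = card (orbit p b) - c"
    "C1 \<noteq> {}" "C2 \<noteq> {}"
proof -
  define i where "i = (p ^^ c) b"
  define q where "q = transpose b i \<circ> p"
  define U where "U = orbit p b"
  define l where "l = card (orbit p b)"
  have perm: "permutation p" using p by (auto simp: permutation_permutes)
  have permq: "permutation q"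
    unfolding q_def by (intro permutation_compose perm permutation_swap_id)
  have mem: "x \<in> orbit p x" for x using perm by (rule permutation_self_in_orbit)
  have eq: "orbit p y = orbit p x" if "y \<in> orbit p x" for x y
    using orbit_eq_of_mem[OF perm that] .
  have eqq: "orbit q y = orbit q x" if "y \<in> orbit q x" for x y
    using orbit_eq_of_mem[OF permq that] .
  have memq: "x \<in> orbit q x" for x using permq by (rule permutation_self_in_orbit)
  define f where "f n = (p ^^ n) b" for n
  have inj: "inj_on f {0..<funpow_dist1 p b b}"
    unfolding f_def by (rule inj_on_funpow_dist1[OF mem])
  have im: "orbit p b = f ` {0..<funpow_dist1 p b b}"
    unfolding f_def by (rule orbit_conv_funpow_dist1[OF mem])
  have l': "funpow_dist1 p b b = l"
    unfolding l_def im card_image[OF inj] by simp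
  have fl: "f l = b" unfolding f_def l'[symmetric] by (rule funpow_dist1_prop[OF mem])
  note inj = inj[unfolded l'] and im = im[unfolded l']
  have cl: "0 < c" "c < l" using c unfolding l_def by auto
  have f0: "f 0 = b" and fc: "f c = i" unfolding f_def i_def by auto
  have fS: "p (f n) = f (Suc n)" for n unfolding f_def by simp
  have fe: "f m = f n \<longleftrightarrow> m = n" if "m < l" "n < l" for m n
    using inj_onD[OF inj, of m n] that by auto
  have q1: "q (f n) = (if Suc n = c then b else if Suc n = l then i else f (Suc n))" if "n < l" for n
  proof -
    have "f (Suc n) \<noteq> b \<and> f (Suc n) \<noteq> i" if "Suc n \<noteq> c" "Suc n \<noteq> l"
      using fe[of "Suc n" 0] fe[of "Suc n" c] that \<open>n < l\<close> cl f0 fc by auto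
    then show ?thesis using fl fc cl unfolding q_def by (auto simp: fS)
  qed
  define C1 where "C1 = f ` {0..<c}"
  define C2 where "C2 = f ` {c..<l}"
  have qb: "orbit q b = C1"
  proof
    show "orbit q b \<subseteq> C1"
    proof (rule orbit_subset_of_closed)
      have *: "q y \<in> C1" if y: "y \<in> C1" for y
      proof -
        obtain n where n: "y = f n" "n < c" using y unfolding C1_def by auto
        have "q y = f (if Suc n = c then 0 else Suc n)" using n q1[of n] f0 cl by auto
        then show ?thesis using n cl unfolding C1_def by auto
      qed
      then show "q y \<in> C1" if "y \<in> C1" for y using that by blast
      show "q b \<in> C1" by (rule *) (use f0 cl in \<open>force simp: C1_def\<close>)
    qed
    have "f n \<in> orbit q b" if "n < c" for n
      using that
    proof (induct n)
      case 0
      then show ?case using memq f0 by simp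
    next
      case (Suc n)
      then show ?case using q1[of n] cl orbit.step[of "f n" q b] by auto
    qed
    then show "C1 \<subseteq> orbit q b" unfolding C1_def by auto
  qed
  have qi: "orbit q i = C2"
  proof
    show "orbit q i \<subseteq> C2"
    proof (rule orbit_subset_of_closed)
      have *: "q y \<in> C2" if y: "y \<in> C2" for y
      proof -
        obtain n where n: "y = f n" "c \<le> n" "n < l" using y unfolding C2_def by auto
        have "q y = f (if Suc n = l then c else Suc n)" using n q1[of n] fc by auto
        then show ?thesis using n cl unfolding C2_def by auto
      qed
      then show "q y \<in> C2" if "y \<in> C2" for y using that by blast
      show "q i \<in> C2" by (rule *) (use fc cl in \<open>force simp: C2_def\<close>)
    qed
    have "f (c + n) \<in> orbit q i" if "c + n < l" for n
      using that
    proof (induct n)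
      case 0
      then show ?case using memq fc by simp
    next
      case (Suc n)
      then show ?case using q1[of "c + n"] cl orbit.step[of "f (c + n)" q i] by auto
    qed
    then show "C2 \<subseteq> orbit q i" unfolding C2_def
      by (auto) (metis le_Suc_ex)
  qed
  have un: "C1 \<union> C2 = U" 
    unfolding U_def im C1_def C2_def image_Un[symmetric] using cl by (simp add: ivl_disj_un)
  have dj: "C1 \<inter> C2 = {}" unfolding C1_def C2_def using fe cl by auto
  have card1: "card C1 = c" unfolding C1_def
    using card_image[OF inj_on_subset[OF inj, of "{0..<c}"]] cl by auto
  have card2: "card C2 = l - c" unfolding C2_def
    using card_image[OF inj_on_subset[OF inj, of "{c..<l}"]] cl by auto
  have bU: "b \<in> C1" "i \<in> C2" using qb qi memq by blast+
  have qU: "orbit q ` U = {C1, C2}"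
  proof -
    have "orbit q x = C1" if "x \<in> C1" for x using that eqq[of x b] qb by auto
    moreover have "orbit q x = C2" if "x \<in> C2" for x using that eqq[of x i] qi by auto
    ultimately show ?thesis using bU unfolding un[symmetric] by (auto simp: image_iff) 
  qed
  have pU: "orbit p ` U = {U}"
  proof -
    have "orbit p x = U" if "x \<in> U" for x using eq that unfolding U_def by blast
    moreover have "b \<in> U" using mem unfolding U_def .
    ultimately show ?thesis by auto
  qed
  have "orbit q ` A = orbit q ` U \<union> (orbit p ` A - orbit p ` U)"
    unfolding q_def
  proof (rule orbits_transpose_outside[OF p])
    show "b \<in> U" "i \<in> U" using bU un by auto
    show "orbit p x \<subseteq> U" if "x \<in> U" for x using that eq unfolding U_def by auto
    show "U \<subseteq> A" unfolding U_def using permutes_orbit_subset[OF p(1)] b by auto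
  qed
  then have "orbit q ` A = insert C1 (insert C2 (orbit p ` A - {orbit p b}))"
    unfolding qU pU unfolding U_def by auto
  from that[OF this[unfolded q_def i_def]] un dj card1 card2 bU show ?thesis
    unfolding U_def l_def by blast
qed

section \<open>The polynomial of a permutation\<close>

text \<open>With \<open>x = 1 - t\<close> and \<open>w = - t\<close> one has
  \<open>x - w = 1\<close>, so this is \<open>(x ^ a - w ^ a) / (x - w)\<close>, the Lucas sequence
  with parameters \<open>x + w = 1 - 2 * t\<close> and \<open>x * w = - t * (1 - t)\<close>.\<close>

definition cycle_factor :: "real \<Rightarrow> nat \<Rightarrow> real" where
  "cycle_factor t a = (1 - t) ^ a - (- t) ^ a"

definition perm_poly :: "('a \<Rightarrow> 'a) \<Rightarrow> 'a set \<Rightarrow> real \<Rightarrow> real" where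
  "perm_poly p A t = (\<Prod>C\<in>orbit p ` A. cycle_factor t (card C))"

lemma cycle_factor_1 [simp]: "cycle_factor t (Suc 0) = 1"
  by (simp add: cycle_factor_def)

text \<open>The addition formula of Lucas sequences. It splits the factor of a joined cycle into a
  multiple of the factor of length \<open>Suc n\<close> and a multiple of that factor's
  derivative.\<close>

lemma cycle_factor_add:
  "cycle_factor t (m + Suc n)
    = cycle_factor t (Suc m) * cycle_factor t (Suc n)
      + t * (1 - t) * cycle_factor t m * cycle_factor t n"
proof -
  define w where "w = - t"
  have t: "t = - w" by (simp add: w_def)
  show ?thesis unfolding cycle_factor_def t
    by (simp add: power_add algebra_simps)
qed

text \<open>The sum runs over the ways to cut a cycle of length \<open>Suc k\<close> in two.
  Multiplied out, the mixed terms form geometric sums in \<open>x\<close> and \<open>w\<close>, each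
  equal to \<open>x ^ k - w ^ k\<close> because \<open>x - w = 1\<close>.\<close>

lemma cycle_factor_convolution:
  "(\<Sum>i<k. cycle_factor t (Suc i) * cycle_factor t (k - i))
    = k * ((1 - t) ^ Suc k + (- t) ^ Suc k) + 2 * t * (1 - t) * cycle_factor t k"
proof -
  define x w where "x = 1 - t" and "w = - t"
  have xw: "x - w = 1" by (simp add: x_def w_def)
  have "(\<Sum>i<k. cycle_factor t (Suc i) * cycle_factor t (k - i))
      = (\<Sum>i<k. (x ^ Suc k + w ^ Suc k)
          - x * w * (w ^ (k - Suc i) * x ^ i + x ^ (k - Suc i) * w ^ i))"
  proof (rule sum.cong)
    fix i assume "i \<in> {..<k}"
    then obtain j where k: "k = Suc (i + j)" using less_imp_Suc_add by auto
    show "cycle_factor t (Suc i) * cycle_factor t (k - i)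
      = x ^ Suc k + w ^ Suc k - x * w * (w ^ (k - Suc i) * x ^ i + x ^ (k - Suc i) * w ^ i)"
      unfolding cycle_factor_def x_def[symmetric] w_def[symmetric] k
      by (simp add: power_add algebra_simps)
  qed simp
  also have "\<dots> = k * (x ^ Suc k + w ^ Suc k)
      - x * w * ((\<Sum>i<k. w ^ (k - Suc i) * x ^ i) + (\<Sum>i<k. x ^ (k - Suc i) * w ^ i))"
    by (simp only: sum_subtractf sum_distrib_left[symmetric] sum.distrib sum_constant card_lessThan distrib_left)
  also have "(\<Sum>i<k. w ^ (k - Suc i) * x ^ i) = x ^ k - w ^ k"
    using power_diff_sumr2[of x k w] xw by simp
  also have "(\<Sum>i<k. x ^ (k - Suc i) * w ^ i) = x ^ k - w ^ k"
    using power_diff_sumr2[of w k x] xw by (simp add: algebra_simps)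
  finally show ?thesis
    by (simp add: cycle_factor_def x_def w_def algebra_simps)
qed

lemma perm_poly_delete:
  assumes s: "s permutes insert n A" and A: "finite A" "n \<notin> A" and ne: "s n \<noteq> n"
  defines "s' \<equiv> transpose n (s n) \<circ> s"
  defines "C \<equiv> orbit s' (s n)"
  shows "perm_poly s (insert n A) t
    = cycle_factor t (Suc (card C)) * (\<Prod>D\<in>orbit s' ` A - {C}. cycle_factor t (card D))"
    and "card (orbit s ` insert n A) = card (orbit s' ` A)"
proof -
  have s': "s' permutes A" unfolding s'_def by (rule delete_permutes) fact+
  have b: "s n \<in> A" using permutes_in_image[OF s, of n] ne by auto
  have sub: "orbit s' x \<subseteq> A" if "x \<in> A" for x
    using permutes_orbit_subset[OF s' that] .
  have C: "C \<subseteq> A" "C \<in> orbit s' ` A" unfolding C_def using sub b by auto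
  then have finC: "finite C" "n \<notin> C" using A finite_subset by auto
  have notin: "insert n C \<notin> orbit s' ` A - {C}" using sub A by auto
  have eq: "orbit s ` insert n A = insert (insert n C) (orbit s' ` A - {C})"
    unfolding C_def s'_def by (rule orbits_delete) fact+
  show "perm_poly s (insert n A) t
    = cycle_factor t (Suc (card C)) * (\<Prod>D\<in>orbit s' ` A - {C}. cycle_factor t (card D))"
    unfolding perm_poly_def eq using notin A finC by simp
  show "card (orbit s ` insert n A) = card (orbit s' ` A)"
    unfolding eq using notin A C(2) card.remove[of "orbit s' ` A" C] by simp
qed

lemma orbits_insert_fixpoint:
  assumes s: "s permutes insert n A" and A: "finite A" "n \<notin> A" and fx: "s n = n"
  shows "orbit s ` insert n A = insert {n} (orbit s ` A)" "{n} \<notin> orbit s ` A"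
proof -
  have perm: "permutation s" using s A by (auto simp: permutation_permutes)
  show "orbit s ` insert n A = insert {n} (orbit s ` A)"
    using fx orbit_eq_singleton_iff[of s n] by auto
  show "{n} \<notin> orbit s ` A"
    using permutation_self_in_orbit[OF perm] A by (metis imageE singletonD)
qed

lemma card_orbits_delete:
  assumes s: "s permutes insert n A" and A: "finite A" "n \<notin> A"
  shows "card (orbit s ` insert n A)
    = card (orbit (transpose n (s n) \<circ> s) ` A) + (if s n = n then 1 else 0)"
proof (cases "s n = n")
  case True
  then show ?thesis using orbits_insert_fixpoint[OF s A] A by simp
next
  case False
  then show ?thesis using perm_poly_delete(2)[OF s A False] by simp
qed

lemma perm_poly_insert_fixpoint:
  assumes s: "s permutes insert n A" and A: "finite A" "n \<notin> A" and fx: "s n = n"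
  shows "perm_poly s (insert n A) t = perm_poly s A t"
  unfolding perm_poly_def using orbits_insert_fixpoint[OF assms] A by simp

text \<open>If \<open>i\<close> is the \<open>c\<close>-th point after \<open>b\<close> on its
  cycle, the cycle is cut into lengths \<open>c\<close> and \<open>card C - c\<close>. If
  \<open>i\<close> lies on another cycle \<open>D\<close>, the two are joined, with the same result
  for all \<open>card D\<close> choices.\<close>

lemma sum_perm_poly_transpose:
  assumes p: "p permutes A" "finite A" and b: "b \<in> A"
  defines "C \<equiv> orbit p b"
  defines "R \<equiv> orbit p ` A - {C}"
  shows "(\<Sum>i\<in>A - {b}. perm_poly (transpose b i \<circ> p) A t)
    = (\<Sum>c\<in>{0<..<card C}. cycle_factor t c * cycle_factor t (card C - c))
        * (\<Prod>D\<in>R. cycle_factor t (card D))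
      + (\<Sum>D\<in>R. card D * cycle_factor t (card C + card D)
        * (\<Prod>E\<in>R - {D}. cycle_factor t (card E)))"
proof -
  define Q where "Q i = perm_poly (transpose b i \<circ> p) A t" for i
  have perm: "permutation p" using p by (auto simp: permutation_permutes)
  have mem: "x \<in> orbit p x" for x using perm by (rule permutation_self_in_orbit)
  have eq: "orbit p y = orbit p x" if "y \<in> orbit p x" for x y
    using orbit_eq_of_mem[OF perm that] .
  have sub: "orbit p x \<subseteq> A" if "x \<in> A" for x
    using permutes_orbit_subset[OF p(1) that] .
  have finC: "finite (orbit p x)" for x using finite_orbit[OF mem] .
  have finR: "finite R" unfolding R_def using p by simp
  have disj: "D \<inter> E = {}" if "D \<in> orbit p ` A" "E \<in> orbit p ` A" "D \<noteq> E" for D E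
    using that eq by (metis disjoint_iff imageE)
  have CA: "C \<in> orbit p ` A" "C \<subseteq> A" "b \<in> C" unfolding C_def using b sub mem by auto
  have U: "A - {b} = (C - {b}) \<union> \<Union>R"
  proof -
    have "A \<subseteq> \<Union>(orbit p ` A)" using mem by auto
    moreover have "\<Union>(orbit p ` A) \<subseteq> A" using sub by auto
    moreover have "\<Union>(orbit p ` A) = C \<union> \<Union>R" using CA(1) unfolding R_def by auto
    ultimately have AU: "A = C \<union> \<Union>R" by (metis subset_antisym)
    have "b \<notin> \<Union>R" using disj CA unfolding R_def by blast
    then show ?thesis using CA(3) by (subst AU) blast
  qed
  have "sum Q (A - {b}) = sum Q (C - {b}) + sum Q (\<Union>R)"
    unfolding U
  proof (rule sum.union_disjoint)
    show "finite (C - {b})" unfolding C_def using finC by simp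
    show "finite (\<Union>R)" using finR finC unfolding R_def by auto
    show "(C - {b}) \<inter> \<Union>R = {}" using disj CA unfolding R_def by blast
  qed
  moreover have "sum Q (\<Union>R) = (\<Sum>D\<in>R. card D * cycle_factor t (card C + card D)
        * (\<Prod>E\<in>R - {D}. cycle_factor t (card E)))"
  proof -
    have "\<forall>D\<in>R. finite D" using finC unfolding R_def by blast
    moreover have "\<forall>D\<in>R. \<forall>E\<in>R. D \<noteq> E \<longrightarrow> D \<inter> E = {}"
      using disj unfolding R_def by blast
    ultimately have "sum Q (\<Union>R) = (\<Sum>D\<in>R. sum Q D)"
      by (simp add: sum.Union_disjoint)
    also have "\<dots> = (\<Sum>D\<in>R. card D * cycle_factor t (card C + card D)
        * (\<Prod>E\<in>R - {D}. cycle_factor t (card E)))"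
    proof (rule sum.cong[OF refl])
      fix D assume D: "D \<in> R"
      have "Q i = cycle_factor t (card C + card D) * (\<Prod>E\<in>R - {D}. cycle_factor t (card E))"
        if i: "i \<in> D" for i
      proof -
        have Di: "D = orbit p i" using D i eq unfolding R_def by blast
        have iA: "i \<in> A" using D i sub unfolding R_def by blast
        have CD: "C \<inter> D = {}" using D CA(1) disj unfolding R_def by blast
        then have "i \<notin> orbit p b" using i unfolding C_def by auto
        from orbits_join[OF p b iA this]
        have o: "orbit (transpose b i \<circ> p) ` A = insert (C \<union> D) (R - {D})"
          unfolding R_def Di C_def by auto
        have "C \<union> D \<notin> R - {D}"
          using disj CA CD unfolding R_def by blast
        moreover have "card (C \<union> D) = card C + card D"
          using CD finC unfolding C_def Di by (intro card_Un_disjoint)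
        ultimately show ?thesis unfolding Q_def perm_poly_def o using finR by simp
      qed
      then show "sum Q D = card D * cycle_factor t (card C + card D)
          * (\<Prod>E\<in>R - {D}. cycle_factor t (card E))" by simp
    qed
    finally show ?thesis .
  qed
  moreover have "sum Q (C - {b})
      = (\<Sum>c\<in>{0<..<card C}. cycle_factor t c * cycle_factor t (card C - c))
        * (\<Prod>D\<in>R. cycle_factor t (card D))"
  proof -
    define f where "f n = (p ^^ n) b" for n
    have inj: "inj_on f {0..<funpow_dist1 p b b}"
      unfolding f_def by (rule inj_on_funpow_dist1[OF mem])
    have im: "C = f ` {0..<funpow_dist1 p b b}"
      unfolding f_def C_def by (rule orbit_conv_funpow_dist1[OF mem])
    have l': "funpow_dist1 p b b = card C" unfolding im card_image[OF inj] by simp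
    note inj = inj[unfolded l'] and im = im[unfolded l']
    have pos: "0 < card C" using l' by simp
    have f0: "f 0 = b" by (simp add: f_def)
    have "{0..<card C} = insert 0 {0<..<card C}" using pos by auto
    then have "C = insert b (f ` {0<..<card C})" using im f0 by (metis image_insert)
    moreover have "b \<notin> f ` {0<..<card C}"
      using inj_onD[OF inj, of 0] pos f0 by fastforce
    ultimately have "f ` {0<..<card C} = C - {b}" by blast
    moreover have inj': "inj_on f {0<..<card C}"
      by (rule inj_on_subset[OF inj]) auto
    ultimately have "sum Q (C - {b}) = (\<Sum>c\<in>{0<..<card C}. Q (f c))"
      using sum.reindex[OF inj', of Q] by (metis (no_types, lifting) comp_apply sum.cong)
    also have "\<dots> = (\<Sum>c\<in>{0<..<card C}. cycle_factor t c * cycle_factor t (card C - c)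
        * (\<Prod>D\<in>R. cycle_factor t (card D)))"
    proof (rule sum.cong[OF refl])
      fix c assume "c \<in> {0<..<card C}"
      then have "0 < c" "c < card (orbit p b)" by (auto simp: C_def)
      then obtain C1 C2 where
        "orbit (transpose b ((p ^^ c) b) \<circ> p) ` A
          = insert C1 (insert C2 (orbit p ` A - {orbit p b}))"
        and C12: "C1 \<union> C2 = orbit p b" "C1 \<inter> C2 = {}" "card C1 = c"
          "card C2 = card (orbit p b) - c" "C1 \<noteq> {}" "C2 \<noteq> {}"
        by (rule orbits_cut[OF p b])
      then have o: "orbit (transpose b (f c) \<circ> p) ` A = insert C1 (insert C2 R)"
        unfolding C_def[symmetric] R_def[symmetric] f_def by simp
      note C12 = C12[folded C_def]
      have "D \<notin> R" if "D \<subseteq> C" "D \<noteq> {}" for D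
        using disj[of C D] CA that unfolding R_def by blast
      then have "C1 \<notin> R" "C2 \<notin> R" using C12 by auto
      moreover have "C1 \<noteq> C2" using C12 by auto
      ultimately show "Q (f c) = cycle_factor t c * cycle_factor t (card C - c)
        * (\<Prod>D\<in>R. cycle_factor t (card D))"
        unfolding Q_def perm_poly_def o using finR C12 by simp
    qed
    finally show ?thesis by (simp add: sum_distrib_right)
  qed
  ultimately show ?thesis unfolding Q_def by simp
qed

section \<open>Cycles of the product with a random long cycle\<close>

lemma cycle_factor_has_derivative:
  "((\<lambda>t. cycle_factor t a) has_real_derivative - real a * cycle_factor t (a - 1)) (at t)"
  unfolding cycle_factor_def
  by (auto intro!: derivative_eq_intros simp: algebra_simps)

lemma perm_poly_at_0:
  assumes "p permutes A" "finite A"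
  shows "perm_poly p A 0 = 1"
proof -
  have "permutation p" using assms by (auto simp: permutation_permutes)
  then have "card (orbit p x) \<noteq> 0" for x
    using finite_orbit[OF permutation_self_in_orbit, of p x] orbit_nonempty[of p x]
    by (simp add: card_eq_0_iff)
  then show ?thesis unfolding perm_poly_def
    by (intro prod.neutral) (auto simp: cycle_factor_def power_0_left)
qed

lemma sum_card_orbits:
  assumes "p permutes A" "finite A"
  shows "(\<Sum>C\<in>orbit p ` A. card C) = card A"
proof -
  have perm: "permutation p" using assms by (auto simp: permutation_permutes)
  have mem: "x \<in> orbit p x" for x using perm by (rule permutation_self_in_orbit)
  have "card (\<Union>(orbit p ` A)) = (\<Sum>C\<in>orbit p ` A. card C)"
  proof (rule card_Union_disjoint)
    show "pairwise disjnt (orbit p ` A)"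
      unfolding pairwise_def disjnt_def
      using orbit_eq_of_mem[OF perm] by (metis disjoint_iff imageE)
    show "finite C" if "C \<in> orbit p ` A" for C using that finite_orbit[OF mem] by blast
  qed
  moreover have "\<Union>(orbit p ` A) = A"
    using mem permutes_orbit_subset[OF assms(1)] by blast
  ultimately show ?thesis by simp
qed

text \<open>Multiplied by \<open>- (1 - t) / t\<close>, the right-hand side is the derivative of
  \<open>(1 - t)^2 * perm_poly p A t\<close>, so that integration leaves only boundary values. The
  cuts are summed by the convolution formula, the joins by the addition formula.\<close>

lemma perm_poly_recurrence:
  assumes s: "s permutes insert n A" and A: "finite A" "n \<notin> A" and ne: "s n \<noteq> n"
  defines "p \<equiv> transpose n (s n) \<circ> s"
  shows "\<exists>g'. (perm_poly p A has_real_derivative g') (at t) \<and>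
    (\<Sum>i\<in>A. perm_poly (transpose (s n) i \<circ> p) A t) - card A * perm_poly s (insert n A) t
      = - t * ((1 - t) * g' - 2 * perm_poly p A t)"
proof -
  define b where "b = s n"
  have p: "p permutes A" unfolding p_def by (rule delete_permutes) fact+
  have b: "b \<in> A" using permutes_in_image[OF s, of n] ne unfolding b_def by auto
  define C where "C = orbit p b"
  define R where "R = orbit p ` A - {C}"
  define f where "f = cycle_factor t"
  define P where "P = (\<Prod>D\<in>R. f (card D))"
  \<comment> \<open>The derivative of the product \<open>P\<close> over the cycles other than
    \<open>C\<close>.\<close>
  define P' where "P' = (\<Sum>D\<in>R. - real (card D) * f (card D - 1) * (\<Prod>E\<in>R - {D}. f (card E)))"
  have perm: "permutation p" using p A by (auto simp: permutation_permutes)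
  have finC: "finite (orbit p x)" for x
    using finite_orbit[OF permutation_self_in_orbit[OF perm]] .
  have pos: "0 < card (orbit p x)" for x
    using finC orbit_nonempty[of p x] by (simp add: card_gt_0_iff)
  have finR: "finite R" unfolding R_def using A by simp
  have CA: "C \<in> orbit p ` A" unfolding C_def using b by simp
  obtain k where k: "card C = Suc k" using pos[of b] unfolding C_def by (cases "card (orbit p b)") auto
  have perm_poly_eq: "perm_poly p A u = cycle_factor u (card C) * (\<Prod>D\<in>R. cycle_factor u (card D))" for u
    unfolding perm_poly_def R_def using A CA by (simp add: prod.remove)
  have deriv: "(perm_poly p A has_real_derivative (- real (card C) * f k * P + P' * f (card C))) (at t)"
  proof -
    have "((\<lambda>u. cycle_factor u (card C) * (\<Prod>D\<in>R. cycle_factor u (card D))) has_real_derivative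
        (- real (card C) * cycle_factor t (card C - 1) * (\<Prod>D\<in>R. cycle_factor t (card D))
          + (\<Sum>D\<in>R. - real (card D) * cycle_factor t (card D - 1)
              * (\<Prod>E\<in>R - {D}. cycle_factor t (card E))) * cycle_factor t (card C))) (at t)"
      by (intro DERIV_mult cycle_factor_has_derivative has_field_derivative_prod)
    then show ?thesis
      unfolding perm_poly_eq[abs_def] P_def P'_def f_def using k by simp
  qed
  have conv: "(\<Sum>c\<in>{0<..<card C}. f c * f (card C - c))
      = k * ((1 - t) ^ Suc k + (- t) ^ Suc k) + 2 * t * (1 - t) * f k"
  proof -
    have "{0<..<card C} = Suc ` {..<k}" unfolding k by (auto simp: image_iff) (metis Suc_pred lessThan_iff not_less_eq)
    then have "(\<Sum>c\<in>{0<..<card C}. f c * f (card C - c)) = (\<Sum>i<k. f (Suc i) * f (k - i))"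
      by (simp add: sum.reindex k)
    then show ?thesis unfolding f_def cycle_factor_convolution .
  qed
  have cardR: "(\<Sum>D\<in>R. real (card D)) = real (card A) - Suc k"
  proof -
    have "(\<Sum>D\<in>orbit p ` A. card D) = card C + (\<Sum>D\<in>R. card D)"
      unfolding R_def using A CA by (simp add: sum.remove)
    then have "card A = Suc k + (\<Sum>D\<in>R. card D)"
      unfolding sum_card_orbits[OF p A(1)] k .
    then show ?thesis by simp
  qed
  \<comment> \<open>The addition formula splits every joined factor. The first pieces are multiples
    of \<open>P\<close> with weights \<open>card D\<close>, which add up to
    \<open>card A - Suc k\<close>; the second pieces add up to a multiple of
    \<open>P'\<close>.\<close>
  have join: "(\<Sum>D\<in>R. card D * f (card C + card D) * (\<Prod>E\<in>R - {D}. f (card E)))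
      = f (Suc (card C)) * P * (real (card A) - Suc k) - t * (1 - t) * f (card C) * P'"
  proof -
    have "card D * f (card C + card D) * (\<Prod>E\<in>R - {D}. f (card E))
        = f (Suc (card C)) * P * card D
          - t * (1 - t) * f (card C) * (- real (card D) * f (card D - 1) * (\<Prod>E\<in>R - {D}. f (card E)))"
      if D: "D \<in> R" for D
    proof -
      obtain e where e: "card D = Suc e" using pos D unfolding R_def by (metis DiffE gr0_implies_Suc imageE)
      have "P = f (card D) * (\<Prod>E\<in>R - {D}. f (card E))"
        unfolding P_def using finR D by (simp add: prod.remove)
      then show ?thesis unfolding e f_def cycle_factor_add by (simp add: algebra_simps)
    qed
    then show ?thesis
      unfolding P'_def cardR[symmetric] by (simp add: sum.distrib sum_distrib_left sum_negf)
  qed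
  \<comment> \<open>For \<open>i = b\<close> the transposition is the identity and contributes
    \<open>perm_poly p A t\<close> itself.\<close>
  have "(\<Sum>i\<in>A. perm_poly (transpose b i \<circ> p) A t)
      = perm_poly p A t + (\<Sum>i\<in>A - {b}. perm_poly (transpose b i \<circ> p) A t)"
    using A b by (simp add: sum.remove)
  also have "(\<Sum>i\<in>A - {b}. perm_poly (transpose b i \<circ> p) A t)
      = (k * ((1 - t) ^ Suc k + (- t) ^ Suc k) + 2 * t * (1 - t) * f k) * P
        + (f (Suc (card C)) * P * (real (card A) - Suc k) - t * (1 - t) * f (card C) * P')"
    unfolding conv[symmetric] join[symmetric] unfolding P_def f_def R_def C_def
    by (rule sum_perm_poly_transpose[OF p A(1) b])
  finally have S: "(\<Sum>i\<in>A. perm_poly (transpose b i \<circ> p) A t) = f (card C) * P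
      + ((k * ((1 - t) ^ Suc k + (- t) ^ Suc k) + 2 * t * (1 - t) * f k) * P
        + (f (Suc (card C)) * P * (real (card A) - Suc k) - t * (1 - t) * f (card C) * P'))"
    unfolding perm_poly_eq P_def f_def .
  have B: "perm_poly s (insert n A) t = f (Suc (card C)) * P"
    unfolding f_def P_def R_def C_def b_def p_def by (rule perm_poly_delete) fact+
  \<comment> \<open>The coefficient of \<open>P\<close>: the term for \<open>i = b\<close>, the
    cuts, and what is left of the joins once \<open>card A\<close> has cancelled.\<close>
  have key: "f (Suc k) + (k * ((1 - t) ^ Suc k + (- t) ^ Suc k) + 2 * t * (1 - t) * f k)
      - Suc k * f (Suc (Suc k)) = t * (1 - t) * Suc k * f k + 2 * t * f (Suc k)"
  proof -
    define X W where "X = (1 - t) ^ k" and "W = (- t) ^ k"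
    show ?thesis unfolding f_def cycle_factor_def power_Suc X_def[symmetric] W_def[symmetric]
      by (simp add: algebra_simps)
  qed
  have "(\<Sum>i\<in>A. perm_poly (transpose b i \<circ> p) A t) - card A * perm_poly s (insert n A) t
    = (f (Suc k) + (k * ((1 - t) ^ Suc k + (- t) ^ Suc k) + 2 * t * (1 - t) * f k)
      - Suc k * f (Suc (Suc k))) * P - t * (1 - t) * f (Suc k) * P'"
    unfolding S B k by (simp add: algebra_simps)
  also have "\<dots> = - t * ((1 - t) * (- real (card C) * f k * P + P' * f (card C))
      - 2 * perm_poly p A t)"
    unfolding key unfolding perm_poly_eq k P_def[symmetric] f_def[symmetric]
    by (simp add: P_def f_def algebra_simps)
  finally show ?thesis using deriv unfolding b_def by blast
qed

section \<open>Summation over all long cycles\<close>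

definition long_cycle_orbits :: "('a \<Rightarrow> 'a) \<Rightarrow> 'a set \<Rightarrow> real" where
  "long_cycle_orbits p A = (\<Sum>c\<in>cyclic_perms A. real (card (orbit (p \<circ> c) ` A)))"

text \<open>Composing \<open>c\<close> with \<open>transpose n j\<close> inserts \<open>n\<close>
  right before \<open>j\<close>. The inverse reads off \<open>j\<close> as the image of
  \<open>n\<close> and deletes \<open>n\<close>.\<close>

lemma cyclic_perms_insert:
  assumes A: "finite A" "A \<noteq> {}" "n \<notin> A"
  shows "bij_betw (\<lambda>(j, c). transpose n j \<circ> c) (A \<times> cyclic_perms A) (cyclic_perms (insert n A))"
proof (rule bij_betw_byWitness[where f' = "\<lambda>c. (c n, transpose n (c n) \<circ> c)"])
  have fixn: "c n = n" if "c \<in> cyclic_perms A" for c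
    using that A unfolding cyclic_perms_def by (auto simp: permutes_def)
  show "\<forall>jc\<in>A \<times> cyclic_perms A. (\<lambda>c. (c n, transpose n (c n) \<circ> c))
      ((\<lambda>(j, c). transpose n j \<circ> c) jc) = jc"
  proof
    fix jc assume "jc \<in> A \<times> cyclic_perms A"
    then obtain j c where jc: "jc = (j, c)" "c \<in> cyclic_perms A" by auto
    have "(transpose n j \<circ> c) n = j" using fixn[OF jc(2)] by simp
    then show "(\<lambda>c. (c n, transpose n (c n) \<circ> c)) ((\<lambda>(j, c). transpose n j \<circ> c) jc) = jc"
      unfolding jc by (simp add: comp_assoc[symmetric])
  qed
  show "\<forall>c\<in>cyclic_perms (insert n A). (\<lambda>(j, c). transpose n j \<circ> c)
      (c n, transpose n (c n) \<circ> c) = c"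
    by (auto simp: comp_assoc[symmetric])
  show "(\<lambda>(j, c). transpose n j \<circ> c) ` (A \<times> cyclic_perms A) \<subseteq> cyclic_perms (insert n A)"
  proof (rule image_subsetI, clarsimp)
    fix j c assume j: "j \<in> A" and c: "c \<in> cyclic_perms A"
    define s where "s = transpose n j \<circ> c"
    have cp: "c permutes A" and cc: "cyclic_on c A" using c unfolding cyclic_perms_def by auto
    have s: "s permutes insert n A" unfolding s_def
      using j by (intro permutes_compose[OF permutes_subset[OF cp]] permutes_swap_id) auto
    have perm: "permutation s" using s A by (auto simp: permutation_permutes)
    have sn: "s n = j" using fixn[OF c] by (simp add: s_def)
    have "transpose n (s n) \<circ> s = c" unfolding sn by (simp add: s_def comp_assoc[symmetric])
    then have "orbit c j = orbit s j - {n}"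
      using orbit_delete[OF perm, of j n] j A by auto
    moreover have "orbit c j = A" using orbit_cyclic_eq3[OF cc j] .
    moreover have "n \<in> orbit s j"
      using permutation_orbit_step[OF perm, of n] permutation_self_in_orbit[OF perm, of n] sn by simp
    ultimately have "orbit s j = insert n A" by blast
    then show "transpose n j \<circ> c \<in> cyclic_perms (insert n A)"
      using s j unfolding cyclic_perms_def s_def[symmetric] cyclic_on_def by auto
  qed
  show "(\<lambda>c. (c n, transpose n (c n) \<circ> c)) ` cyclic_perms (insert n A) \<subseteq> A \<times> cyclic_perms A"
  proof (rule image_subsetI)
    fix c assume c: "c \<in> cyclic_perms (insert n A)"
    have cp: "c permutes insert n A" and cc: "cyclic_on c (insert n A)"
      using c unfolding cyclic_perms_def by auto
    have perm: "permutation c" using cp A by (auto simp: permutation_permutes)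
    have orb: "orbit c x = insert n A" if "x \<in> insert n A" for x
      using orbit_cyclic_eq3[OF cc that] .
    have "c n \<noteq> n" using orb[of n] orbit_eq_singleton_iff[of c n] A by auto
    then have cn: "c n \<in> A" using permutes_in_image[OF cp, of n] by auto
    have "orbit (transpose n (c n) \<circ> c) (c n) = A"
      using orbit_delete[OF perm \<open>c n \<noteq> n\<close>] orb[of "c n"] cn A by auto
    then show "(c n, transpose n (c n) \<circ> c) \<in> A \<times> cyclic_perms A"
      using cn delete_permutes[OF cp A(3)] unfolding cyclic_perms_def cyclic_on_def by auto
  qed
qed

lemma finite_cyclic_perms: "finite A \<Longrightarrow> finite (cyclic_perms A)"
  unfolding cyclic_perms_def by (rule finite_subset[OF _ finite_permutations]) auto

lemma cyclic_perms_singleton: "cyclic_perms {a} = {id}"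
proof -
  have "orbit id a = {a}" by (simp add: orbit_eq_singleton_iff)
  then have "cyclic_on id {a}" by (simp add: cyclic_on_def)
  then show ?thesis by (auto simp: cyclic_perms_def)
qed

lemma card_cyclic_perms:
  assumes "finite A" "A \<noteq> {}"
  shows "card (cyclic_perms A) = fact (card A - 1)"
  using assms
proof (induct rule: finite_ne_induct)
  case (singleton a)
  then show ?case by (simp add: cyclic_perms_singleton)
next
  case (insert n A)
  have "card (cyclic_perms (insert n A)) = card (A \<times> cyclic_perms A)"
    using bij_betw_same_card[OF cyclic_perms_insert[of A n]] insert by simp
  also have "\<dots> = card A * fact (card A - 1)" using insert by (simp add: card_cartesian_product)
  also have "\<dots> = fact (card A)"
    using insert fact_reduce[of "card A", where 'a = nat] by (simp add: card_gt_0_iff)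
  finally show ?case using insert by simp
qed

text \<open>Write the long cycles as \<open>transpose n j\<close> after a long cycle
  \<open>c\<close> on \<open>A\<close> and delete \<open>n\<close> from the product with
  \<open>s\<close>. If \<open>s\<close> fixes \<open>n\<close>, this leaves \<open>s\<close> after
  \<open>c\<close> for every \<open>j\<close>. Otherwise it leaves all transpositions with
  \<open>s n\<close>, and the one \<open>j\<close> that \<open>s\<close> maps to \<open>n\<close>
  accounts for the factorial.\<close>

lemma long_cycle_orbits_insert:
  assumes A: "finite A" "A \<noteq> {}" "n \<notin> A" and s: "s permutes insert n A"
  shows "long_cycle_orbits s (insert n A) = (if s n = n then card A * long_cycle_orbits s A
    else fact (card A - 1)
      + (\<Sum>i\<in>A. long_cycle_orbits (transpose (s n) i \<circ> (transpose n (s n) \<circ> s)) A))"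
proof -
  \<comment> \<open>In the product \<open>n\<close> goes to \<open>s j\<close>. Deleting
    \<open>n\<close> leaves \<open>q j\<close> after \<open>c\<close>, and a cycle is lost exactly
    when \<open>s j = n\<close>.\<close>
  define q where "q j = transpose n (s j) \<circ> s \<circ> transpose n j" for j
  have inj: "s u = s v \<longleftrightarrow> u = v" for u v
    using permutes_inj[OF s] by (simp add: inj_eq)
  have step: "real (card (orbit (s \<circ> (transpose n j \<circ> c)) ` insert n A))
      = card (orbit (q j \<circ> c) ` A) + (if s j = n then 1 else 0)"
    if j: "j \<in> A" and c: "c \<in> cyclic_perms A" for j c
  proof -
    have cp: "c permutes A" using c unfolding cyclic_perms_def by auto
    define z where "z = s \<circ> (transpose n j \<circ> c)"
    have z: "z permutes insert n A" unfolding z_def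
      using j by (intro permutes_compose[OF _ s] permutes_compose[OF permutes_subset[OF cp]] permutes_swap_id) auto
    have cn: "c n = n" using cp A by (auto simp: permutes_def)
    then have zn: "z n = s j" by (simp add: z_def)
    have "transpose n (s j) \<circ> z = q j \<circ> c" by (simp add: z_def q_def comp_assoc)
    then have "card (orbit z ` insert n A) = card (orbit (q j \<circ> c) ` A) + (if s j = n then 1 else 0)"
      using card_orbits_delete[OF z A(1,3)] unfolding zn by simp
    then show ?thesis unfolding z_def by simp
  qed
  have "long_cycle_orbits s (insert n A)
      = (\<Sum>(j, c)\<in>A \<times> cyclic_perms A. real (card (orbit (s \<circ> (transpose n j \<circ> c)) ` insert n A)))"
    unfolding long_cycle_orbits_def
    using sum.reindex_bij_betw[OF cyclic_perms_insert[OF A],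
        of "\<lambda>c. real (card (orbit (s \<circ> c) ` insert n A))"]
    by (simp add: case_prod_unfold)
  also have "\<dots> = (\<Sum>j\<in>A. \<Sum>c\<in>cyclic_perms A. real (card (orbit (s \<circ> (transpose n j \<circ> c)) ` insert n A)))"
    by (simp add: sum.cartesian_product)
  also have "\<dots> = (\<Sum>j\<in>A. long_cycle_orbits (q j) A + (if s j = n then fact (card A - 1) else 0))"
    using step card_cyclic_perms[OF A(1,2)]
    by (intro sum.cong refl) (simp add: long_cycle_orbits_def sum.distrib)
  finally have main: "long_cycle_orbits s (insert n A)
      = (\<Sum>j\<in>A. long_cycle_orbits (q j) A + (if s j = n then fact (card A - 1) else 0))" .
  show ?thesis
  proof (cases "s n = n")
    case True
    have "q j = s \<and> s j \<noteq> n" if "j \<in> A" for j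
    proof -
      have sj: "s j \<noteq> n" using inj[of j n] True that A by auto
      have "q j x = s x" for x
        unfolding q_def using inj True sj
        by (auto simp: Transposition.transpose_def)
      then show ?thesis using sj by blast
    qed
    then show ?thesis unfolding main using True by simp
  next
    case False
    define b where "b = s n"
    define p where "p = transpose n b \<circ> s"
    have p: "p permutes A" unfolding p_def b_def by (rule delete_permutes[OF s A(3)])
    \<comment> \<open>Both sides send \<open>j\<close> to \<open>b\<close>, send the preimage of
      \<open>n\<close> under \<open>s\<close> to \<open>p j\<close>, fix \<open>n\<close>, and agree
      with \<open>s\<close> elsewhere.\<close>
    have q: "q j = transpose b (p j) \<circ> p" if "j \<in> A" for j
    proof
      fix x
      have bn: "b \<noteq> n" "j \<noteq> n" using False that A unfolding b_def by auto
      have bs: "s y = b \<longleftrightarrow> y = n" for y using inj unfolding b_def by auto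
      have pn: "p y = (if y = n then n else if s y = n then b else s y)" for y
        unfolding p_def comp_apply Transposition.transpose_def using bn bs[of y] by (smt (verit))
      have pj: "p j = (if s j = n then b else s j)" unfolding pn using bn by simp
      have px: "p x = (if x = n then n else if s x = n then b else s x)" by (rule pn)
      have sn: "s n = b" unfolding b_def ..
      show "q j x = (transpose b (p j) \<circ> p) x"
      proof (cases "x = n \<or> x = j")
        case True
        then show ?thesis
          unfolding q_def comp_apply pj px Transposition.transpose_def using bn bs[of j] sn by (smt (verit))
      next
        case False
        then have "s x \<noteq> s j" "s x \<noteq> b" using inj bs by blast+
        then show ?thesis
          unfolding q_def comp_apply pj px Transposition.transpose_def using False bn by (smt (verit))
      qed
    qed
    obtain m where m: "m \<in> A" "s m = n"
    proof -
      have "n \<in> s ` insert n A" using permutes_image[OF s] by auto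
      then show ?thesis using that False by auto
    qed
    have "(\<Sum>j\<in>A. if s j = n then fact (card A - 1) else 0) = (\<Sum>j\<in>A. if j = m then fact (card A - 1) else (0::real))"
      using m inj by (intro sum.cong) auto
    also have "\<dots> = fact (card A - 1)" using m A by simp
    finally have 1: "(\<Sum>j\<in>A. if s j = n then fact (card A - 1) else (0::real)) = fact (card A - 1)" .
    have "(\<Sum>j\<in>A. long_cycle_orbits (q j) A) = (\<Sum>j\<in>A. long_cycle_orbits (transpose b (p j) \<circ> p) A)"
      using q by (intro sum.cong) auto
    also have "\<dots> = (\<Sum>i\<in>A. long_cycle_orbits (transpose b i \<circ> p) A)"
      using sum.reindex_bij_betw[OF permutes_imp_bij[OF p], of "\<lambda>i. long_cycle_orbits (transpose b i \<circ> p) A"] .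
    finally show ?thesis unfolding main sum.distrib 1 using False unfolding b_def p_def by simp
  qed
qed

text \<open>Division by the number \<open>fact (card A - 1)\<close> of long cycles yields an
  expectation. In the induction, a fixed point changes neither the expectation nor the polynomial,
  since a cycle of length 1 has factor 1. Otherwise both sides obey the same recursion up to a
  derivative. The integrand at 0 is a division by zero, a single value that does not affect the
  integral.\<close>

theorem has_integral_long_cycle_orbits:
  assumes "finite A" "A \<noteq> {}" "p permutes A"
  shows "((\<lambda>t. (1 - (1 - t) * perm_poly p A t) / t) has_integral
    long_cycle_orbits p A / fact (card A - 1)) {0..1}"
  using assms
proof (induct arbitrary: p rule: finite_ne_induct)
  case (singleton a)
  then have p: "p = id" by simp
  have o: "orbit id a = {a}" by (simp add: orbit_eq_singleton_iff)
  have "((\<lambda>t::real. 1) has_integral (1::real)) {0..1}"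
    using has_integral_const_real[of "1::real" 0 1] by simp
  then have "((\<lambda>t. (1 - (1 - t) * perm_poly p {a} t) / t) has_integral 1) {0..1}"
    by (rule has_integral_spike_finite[of "{0}", rotated 2]) (auto simp: perm_poly_def p o)
  moreover have "long_cycle_orbits p {a} = 1"
    unfolding long_cycle_orbits_def cyclic_perms_singleton p by (simp add: o)
  ultimately show ?case by simp
next
  case (insert n A)
  note A = insert(1,2,3) and s = insert.prems
  have pos: "0 < card A" using A by (simp add: card_gt_0_iff)
  have cA: "card (insert n A) - 1 = card A" using A by simp
  have fact: "fact (card A) = real (card A) * fact (card A - 1)"
    using fact_reduce[OF pos, where 'a = real] .
  show ?case
  proof (cases "p n = n")
    case True
    have "p permutes A"
      using delete_permutes[OF s A(3)] True by simp
    from insert.hyps(4)[OF this] show ?thesis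
      unfolding perm_poly_insert_fixpoint[OF s A(1,3) True] cA fact
        long_cycle_orbits_insert[OF A s] using True pos by simp
  next
    case False
    define q where "q = transpose n (p n) \<circ> p"
    have q: "q permutes A" unfolding q_def by (rule delete_permutes[OF s A(3)])
    have pn: "p n \<in> A" using permutes_in_image[OF s, of n] False by auto
    txt \<open>Up to the factor \<open>card A\<close>, the integrand for \<open>p\<close> is the sum of the integrands for the
      permutations \<open>transpose (p n) i \<circ> q\<close> plus the derivative of \<open>- (1 - t)\<^sup>2 * g t\<close>,
      which contributes \<open>g 0 = 1\<close>.\<close>
    define g where "g = perm_poly q A"
    obtain g' where g': "(g has_real_derivative g' t) (at t)"
      and rec: "(\<Sum>i\<in>A. perm_poly (transpose (p n) i \<circ> q) A t) - card A * perm_poly p (insert n A) t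
        = - t * ((1 - t) * g' t - 2 * g t)" for t
      using perm_poly_recurrence[OF s A(1,3) False] unfolding q_def g_def by metis
    have "transpose (p n) i \<circ> q permutes A" if "i \<in> A" for i
      using pn that by (intro permutes_compose[OF q] permutes_swap_id) auto
    then have 1: "((\<lambda>t. \<Sum>i\<in>A. (1 - (1 - t) * perm_poly (transpose (p n) i \<circ> q) A t) / t) has_integral
        (\<Sum>i\<in>A. long_cycle_orbits (transpose (p n) i \<circ> q) A / fact (card A - 1))) {0..1}"
      by (intro has_integral_sum A insert.hyps(4))
    have "((\<lambda>t. - ((1 - t)\<^sup>2 * g t)) has_real_derivative - ((1 - t)\<^sup>2 * g' t - 2 * (1 - t) * g t)) (at t)" for t
    proof -
      have "((\<lambda>t. (1 - t)\<^sup>2) has_real_derivative - 2 * (1 - t)) (at t)"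
        by (auto intro!: derivative_eq_intros)
      from DERIV_minus[OF DERIV_mult[OF this g']] show ?thesis
        by (rule DERIV_cong) (simp add: algebra_simps)
    qed
    then have "((\<lambda>t. - ((1 - t)\<^sup>2 * g' t - 2 * (1 - t) * g t)) has_integral
        (- ((1 - 1)\<^sup>2 * g 1) - (- ((1 - 0)\<^sup>2 * g 0)))) {0..1}"
      by (intro fundamental_theorem_of_calculus)
         (simp_all add: has_real_derivative_iff_has_vector_derivative[symmetric] has_field_derivative_at_within)
    moreover have "g 0 = 1" unfolding g_def by (rule perm_poly_at_0[OF q A(1)])
    ultimately have "((\<lambda>t. - ((1 - t)\<^sup>2 * g' t - 2 * (1 - t) * g t)) has_integral 1) {0..1}"
      by simp
    from has_integral_add[OF 1 this]
    have total: "((\<lambda>t. (\<Sum>i\<in>A. (1 - (1 - t) * perm_poly (transpose (p n) i \<circ> q) A t) / t)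
        + - ((1 - t)\<^sup>2 * g' t - 2 * (1 - t) * g t)) has_integral
        ((\<Sum>i\<in>A. long_cycle_orbits (transpose (p n) i \<circ> q) A / fact (card A - 1)) + 1)) {0..1}" .
    have eq: "card A * ((1 - (1 - t) * perm_poly p (insert n A) t) / t)
        = (\<Sum>i\<in>A. (1 - (1 - t) * perm_poly (transpose (p n) i \<circ> q) A t) / t)
          + - ((1 - t)\<^sup>2 * g' t - 2 * (1 - t) * g t)" if "t \<noteq> 0" for t
    proof -
      define S where "S = (\<Sum>i\<in>A. perm_poly (transpose (p n) i \<circ> q) A t)"
      have "(\<Sum>i\<in>A. (1 - (1 - t) * perm_poly (transpose (p n) i \<circ> q) A t) / t)
          = (card A - (1 - t) * S) / t"
        unfolding S_def by (simp add: sum_divide_distrib[symmetric] sum_subtractf sum_distrib_left)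
      moreover have S: "S = card A * perm_poly p (insert n A) t - t * ((1 - t) * g' t - 2 * g t)"
        using rec[of t] unfolding S_def by linarith
      have "card A - (1 - t) * S = card A * (1 - (1 - t) * perm_poly p (insert n A) t)
          + t * ((1 - t) * ((1 - t) * g' t - 2 * g t))"
        unfolding S by (simp add: algebra_simps)
      then have "(card A - (1 - t) * S) / t = card A * ((1 - (1 - t) * perm_poly p (insert n A) t) / t)
          + (1 - t) * ((1 - t) * g' t - 2 * g t)"
        using that by (simp add: add_divide_distrib)
      ultimately show ?thesis
        by (simp add: algebra_simps power2_eq_square)
    qed
    have "((\<lambda>t. card A * ((1 - (1 - t) * perm_poly p (insert n A) t) / t)) has_integral
        ((\<Sum>i\<in>A. long_cycle_orbits (transpose (p n) i \<circ> q) A / fact (card A - 1)) + 1)) {0..1}"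
    proof (rule has_integral_spike_finite[OF _ _ total])
      show "finite {0::real}" by simp
      show "card A * ((1 - (1 - t) * perm_poly p (insert n A) t) / t)
        = (\<Sum>i\<in>A. (1 - (1 - t) * perm_poly (transpose (p n) i \<circ> q) A t) / t)
          + - ((1 - t)\<^sup>2 * g' t - 2 * (1 - t) * g t)" if "t \<in> {0..1} - {0}" for t
        by (rule eq) (use that in auto)
    qed
    from has_integral_mult_right[OF this, of "1 / card A"]
    have "((\<lambda>t. (1 - (1 - t) * perm_poly p (insert n A) t) / t) has_integral
        ((\<Sum>i\<in>A. long_cycle_orbits (transpose (p n) i \<circ> q) A / fact (card A - 1)) + 1) / card A) {0..1}"
      using pos by simp
    moreover have "((\<Sum>i\<in>A. long_cycle_orbits (transpose (p n) i \<circ> q) A / fact (card A - 1)) + 1) / card A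
        = long_cycle_orbits p (insert n A) / fact (card A)"
      unfolding long_cycle_orbits_insert[OF A s] fact using False pos
      by (simp add: q_def sum_divide_distrib[symmetric] field_simps)
    ultimately show ?thesis unfolding cA by simp
  qed
qed

section \<open>Faces of random embeddings of multistars\<close>

text \<open>Cycles of \<open>phi\<close> alternate between \<open>A\<close> and \<open>B\<close>, so
  each meets \<open>A\<close>, and its trace there is a cycle of the second iterate. Distinct cycles
  are disjoint and hence have distinct traces.\<close>

lemma card_orbits_bipartite:
  assumes phi: "phi permutes A \<union> B" "finite (A \<union> B)" and AB: "A \<inter> B = {}"
    and maps: "\<And>x. x \<in> A \<Longrightarrow> phi x \<in> B" "\<And>x. x \<in> B \<Longrightarrow> phi x \<in> A"
    and psi: "\<And>x. x \<in> A \<Longrightarrow> psi x = phi (phi x)"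
  shows "card (orbit phi ` (A \<union> B)) = card (orbit psi ` A)"
proof -
  have perm: "permutation phi" using phi by (auto simp: permutation_permutes)
  have mem: "x \<in> orbit phi x" for x using perm by (rule permutation_self_in_orbit)
  have restrict: "orbit phi d \<inter> A = orbit psi d" if d: "d \<in> A" for d
  proof
    \<comment> \<open>A point of \<open>B\<close> on the orbit is recorded through its image in
      \<open>A\<close>, so that the induction can advance by single steps of
      \<open>phi\<close>.\<close>
    have "(y \<in> A \<longrightarrow> y \<in> orbit psi d) \<and> (y \<in> B \<longrightarrow> phi y \<in> orbit psi d)" if "y \<in> orbit phi d" for y
      using that
    proof induct
      case base
      then show ?case using maps(1)[OF d] AB psi[OF d] orbit.base[of psi d] by auto
    next
      case (step y)
      show ?case
      proof (cases "y \<in> A")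
        case True
        then show ?thesis using step maps(1)[OF True] AB psi[OF True] orbit.step[of y psi d] by auto
      next
        case False
        have "y \<in> A \<union> B" using step(1) permutes_orbit_subset[OF phi(1), of d] d by auto
        then have "y \<in> B" using False by auto
        then show ?thesis using step(2) maps(2)[of y] AB by auto
      qed
    qed
    then show "orbit phi d \<inter> A \<subseteq> orbit psi d" by blast
    have "y \<in> orbit phi d \<inter> A" if "y \<in> orbit psi d" for y
      using that
    proof induct
      case base
      then show ?case unfolding psi[OF d] using maps(2)[OF maps(1)[OF d]]
        by (auto intro: orbit.intros)
    next
      case (step y)
      then show ?case using psi[of y] maps(2)[OF maps(1), of y]
        by (auto intro: orbit.intros)
    qed
    then show "orbit psi d \<subseteq> orbit phi d \<inter> A" by blast
  qed
  have "orbit phi ` B \<subseteq> orbit phi ` A"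
    using maps(2) permutation_orbit_step[OF perm] by (metis imageI image_subsetI)
  then have "orbit phi ` (A \<union> B) = orbit phi ` A" by auto
  moreover have "(\<lambda>C. C \<inter> A) ` orbit phi ` A = orbit psi ` A"
    unfolding image_image using restrict by (intro image_cong) auto
  moreover have "inj_on (\<lambda>C. C \<inter> A) (orbit phi ` A)"
  proof (rule inj_onI)
    fix C D assume "C \<in> orbit phi ` A" and D: "D \<in> orbit phi ` A" and eq: "C \<inter> A = D \<inter> A"
    then obtain x where x: "x \<in> A" "C = orbit phi x" by blast
    then have "x \<in> D" using eq mem[of x] by blast
    then show "C = D" using x D orbit_eq_of_mem[OF perm] by blast
  qed
  ultimately show ?thesis using card_image by metis
qed

lemma dart_rev_dart_rev [simp]: "dart_rev (dart_rev d) = d"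
  by (simp add: dart_rev_def)

text \<open>A rotation keeps darts at their vertex, so the image of a dart determines which rotation
  was applied, and that rotation is injective.\<close>

lemma face_perm_permutes:
  assumes fin: "finite (edges G)"
    and rot: "\<And>d. d \<in> darts G \<Longrightarrow> \<pi> (dart_vertex G d) permutes darts_at G (dart_vertex G d)"
  shows "face_perm G \<pi> permutes darts G"
proof -
  have at: "d \<in> darts_at G (dart_vertex G d)" if "d \<in> darts G" for d
    using that by (simp add: darts_at_def)
  have img: "\<pi> (dart_vertex G d) d \<in> darts_at G (dart_vertex G d)" if "d \<in> darts G" for d
    using permutes_in_image[OF rot[OF that]] at[OF that] by simp
  have "inj_on (face_perm G \<pi>) (darts G)"
  proof (rule inj_onI)
    fix d e assume d: "d \<in> darts G" and e: "e \<in> darts G" and "face_perm G \<pi> d = face_perm G \<pi> e"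
    then have "dart_rev (\<pi> (dart_vertex G d) d) = dart_rev (\<pi> (dart_vertex G e) e)"
      by (simp add: face_perm_def)
    then have eq: "\<pi> (dart_vertex G d) d = \<pi> (dart_vertex G e) e"
      by (metis dart_rev_dart_rev)
    then have "dart_vertex G d = dart_vertex G e"
      using img[OF d] img[OF e] unfolding darts_at_def by auto
    then show "d = e" using eq permutes_inj[OF rot[OF d]] by (auto dest: injD)
  qed
  moreover have "face_perm G \<pi> ` darts G \<subseteq> darts G"
  proof (rule image_subsetI)
    fix d assume d: "d \<in> darts G"
    then have "\<pi> (dart_vertex G d) d \<in> darts G" using img by (simp add: darts_at_def)
    then show "face_perm G \<pi> d \<in> darts G"
      using d by (simp add: face_perm_def darts_def dart_rev_def mem_Times_iff)
  qed
  moreover have "finite (darts G)" using fin by (simp add: darts_def)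
  ultimately have "bij_betw (face_perm G \<pi>) (darts G) (darts G)"
    by (simp add: bij_betw_def endo_inj_surj)
  then show ?thesis by (rule bij_imp_permutes) (simp add: face_perm_def)
qed

lemma cyclic_perms_nonempty:
  assumes "finite A" "A \<noteq> {}"
  shows "cyclic_perms A \<noteq> {}"
  using card_cyclic_perms[OF assms] by auto

section \<open>Darts of the multistar and the outer rotations moved to the center\<close>

lemma darts_multistar: "darts (multistar lam) = (SIGMA i:{..<length lam}. {..<lam ! i}) \<times> UNIV"
  by (simp add: darts_def multistar_def)

lemma dart_vertex_multistar: "dart_vertex (multistar lam) ((i, j), c) = (if c then Outer i else Center)"
  by (simp add: dart_vertex_def multistar_def)

lemma darts_at_multistar:
  "darts_at (multistar lam) Center = (SIGMA i:{..<length lam}. {..<lam ! i}) \<times> {False}"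
  "i < length lam \<Longrightarrow> darts_at (multistar lam) (Outer i) = ({i} \<times> {..<lam ! i}) \<times> {True}"
  by (auto simp: darts_at_def darts_multistar dart_vertex_multistar split: if_splits)

definition block :: "nat list \<Rightarrow> nat \<Rightarrow> (nat \<times> nat) dart set" where
  "block lam i = ({i} \<times> {..<lam ! i}) \<times> {False}"

text \<open>The rotations at the outer vertices, moved to the darts at the center along the edges.\<close>

definition outer_perm :: "nat list \<Rightarrow> (star_vertex \<Rightarrow> (nat \<times> nat) dart \<Rightarrow> (nat \<times> nat) dart) \<Rightarrow>
    (nat \<times> nat) dart \<Rightarrow> (nat \<times> nat) dart" where
  "outer_perm lam f d = (if d \<in> darts_at (multistar lam) Center
    then dart_rev (f (Outer (fst (fst d))) (dart_rev d)) else d)"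

context
  fixes lam :: "nat list" and f :: "star_vertex \<Rightarrow> (nat \<times> nat) dart \<Rightarrow> (nat \<times> nat) dart"
  assumes pos: "\<And>x. x \<in> set lam \<Longrightarrow> 0 < x"
    and rot: "\<And>i. i < length lam \<Longrightarrow> f (Outer i) \<in> cyclic_perms (darts_at (multistar lam) (Outer i))"
begin

text \<open>Reversing darts conjugates the rotation at \<open>Outer i\<close> to the restriction of
  \<open>outer_perm\<close> to the block, and conjugation preserves long cycles.\<close>

lemma orbit_outer_perm:
  assumes d: "d \<in> block lam i" and i: "i < length lam"
  shows "orbit (outer_perm lam f) d = block lam i"
proof -
  let ?B = "darts_at (multistar lam) (Outer i)"
  have cyc: "cyclic_on (f (Outer i)) ?B" using rot[OF i] by (simp add: cyclic_perms_def)
  have dB: "dart_rev d \<in> ?B" using d i by (auto simp: darts_at_multistar block_def dart_rev_def)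
  have orb: "orbit (f (Outer i)) (dart_rev d) = ?B" by (rule orbit_cyclic_eq3[OF cyc dB])
  have "dart_rev ` orbit (f (Outer i)) (dart_rev d) = orbit (outer_perm lam f) (dart_rev (dart_rev d))"
  proof (rule orbit_inverse)
    show "dart_rev d \<in> orbit (f (Outer i)) (dart_rev d)" using orb dB by simp
    show "outer_perm lam f (dart_rev x) = dart_rev (f (Outer i) x)"
      if "x \<in> orbit (f (Outer i)) (dart_rev d)" for x
      using that i unfolding orb outer_perm_def by (auto simp: darts_at_multistar dart_rev_def)
  qed
  moreover have "dart_rev ` ?B = block lam i"
    using i by (force simp: darts_at_multistar block_def dart_rev_def)
  ultimately show ?thesis unfolding orb by simp
qed

lemma center_darts: "darts_at (multistar lam) Center = (\<Union>i<length lam. block lam i)"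
  by (auto simp: darts_at_multistar block_def)

lemma outer_perm_permutes: "outer_perm lam f permutes darts_at (multistar lam) Center"
proof -
  let ?A = "darts_at (multistar lam) Center"
  have fin: "finite ?A" by (simp add: darts_at_multistar)
  have img: "outer_perm lam f d \<in> ?A" if d: "d \<in> ?A" for d
  proof -
    obtain i where "i < length lam" "d \<in> block lam i" using d unfolding center_darts by auto
    then show ?thesis using orbit_outer_perm orbit.base[of "outer_perm lam f" d]
      unfolding center_darts by auto
  qed
  have "?A \<subseteq> outer_perm lam f ` ?A"
  proof
    fix d assume d: "d \<in> ?A"
    then obtain i where i: "i < length lam" "d \<in> block lam i" unfolding center_darts by auto
    then have orb: "orbit (outer_perm lam f) d = block lam i" by (intro orbit_outer_perm)
    \<comment> \<open>Lying in its own orbit, \<open>d\<close> has a preimage in its block.\<close>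
    then have "d \<in> orbit (outer_perm lam f) d" using i by simp
    then show "d \<in> outer_perm lam f ` ?A"
    proof cases
      case base
      then show ?thesis using d by (metis imageI)
    next
      case (step y)
      then have "y \<in> ?A" using orb i unfolding center_darts by auto
      then show ?thesis using step by (metis imageI)
    qed
  qed
  moreover have "outer_perm lam f ` ?A \<subseteq> ?A" using img by blast
  ultimately have "bij_betw (outer_perm lam f) ?A ?A"
    using fin by (simp add: bij_betw_def finite_surj_inj subset_antisym)
  then show ?thesis by (rule bij_imp_permutes) (simp add: outer_perm_def)
qed

text \<open>The cycles are the blocks. Positive parts make the blocks nonempty, hence distinct, so
  equal parts still give separate factors.\<close>

lemma perm_poly_outer_perm:
  "perm_poly (outer_perm lam f) (darts_at (multistar lam) Center) t
    = prod_list (map (cycle_factor t) lam)"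
proof -
  have ne: "block lam i \<noteq> {}" if "i < length lam" for i
    using pos[of "lam ! i"] that by (auto simp: block_def)
  have "orbit (outer_perm lam f) ` block lam i = {block lam i}" if "i < length lam" for i
    using orbit_outer_perm[OF _ that] ne[OF that] by auto
  then have "orbit (outer_perm lam f) ` darts_at (multistar lam) Center = block lam ` {..<length lam}"
    unfolding center_darts image_UN by auto
  moreover have "inj_on (block lam) {..<length lam}"
  proof (rule inj_onI)
    fix i j assume "i \<in> {..<length lam}" "block lam i = block lam j"
    then show "i = j" using ne[of i] unfolding block_def by auto
  qed
  moreover have "card (block lam i) = lam ! i" for i
    by (simp add: block_def card_cartesian_product)
  ultimately show ?thesis
    unfolding perm_poly_def
    by (simp add: prod.reindex prod.list_conv_set_nth atLeast0LessThan)
qed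

text \<open>A face alternates between darts at the center and darts at outer vertices, and two steps
  from a center dart amount to \<open>c\<close> followed by \<open>outer_perm lam f\<close>.\<close>

lemma card_faces_multistar:
  assumes c: "c \<in> cyclic_perms (darts_at (multistar lam) Center)"
  shows "card (faces (multistar lam) (f(Center := c)))
    = card (orbit (outer_perm lam f \<circ> c) ` darts_at (multistar lam) Center)"
proof -
  define A where "A = darts_at (multistar lam) Center"
  define B where "B = (SIGMA i:{..<length lam}. {..<lam ! i}) \<times> {True}"
  define phi where "phi = face_perm (multistar lam) (f(Center := c))"
  have AB: "darts (multistar lam) = A \<union> B" "A \<inter> B = {}" 
    by (auto simp: A_def B_def darts_at_multistar darts_multistar)
  have cA: "c permutes A" using c by (simp add: cyclic_perms_def A_def)
  have fp: "f (Outer i) permutes darts_at (multistar lam) (Outer i)" if "i < length lam" for i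
    using rot[OF that] by (simp add: cyclic_perms_def)
  have phiA: "phi x = dart_rev (c x)" "dart_rev (c x) \<in> B" if x: "x \<in> A" for x
  proof -
    show "phi x = dart_rev (c x)"
      using x by (auto simp: phi_def face_perm_def A_def darts_at_multistar darts_multistar dart_vertex_multistar)
    have "c x \<in> A" using permutes_in_image[OF cA] x by simp
    then show "dart_rev (c x) \<in> B" by (auto simp: A_def B_def darts_at_multistar dart_rev_def)
  qed
  have phiB: "phi x = outer_perm lam f (dart_rev x)" "phi x \<in> A" if x: "x \<in> B" for x
  proof -
    obtain i j where ij: "x = ((i, j), True)" "i < length lam" "j < lam ! i" using x by (auto simp: B_def)
    have d: "dart_rev x \<in> A" using ij by (auto simp: A_def darts_at_multistar dart_rev_def)
    show "phi x = outer_perm lam f (dart_rev x)"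
      using ij d unfolding outer_perm_def A_def[symmetric]
      by (simp add: phi_def face_perm_def darts_multistar dart_vertex_multistar) (simp add: dart_rev_def)
    then show "phi x \<in> A" using d permutes_in_image[OF outer_perm_permutes] by (simp add: A_def)
  qed
  have "phi permutes A \<union> B"
    unfolding phi_def AB(1)[symmetric]
  proof (rule face_perm_permutes)
    show "finite (edges (multistar lam))" by (simp add: multistar_def)
    show "(f(Center := c)) (dart_vertex (multistar lam) d)
        permutes darts_at (multistar lam) (dart_vertex (multistar lam) d)"
      if "d \<in> darts (multistar lam)" for d
      using that cA fp by (auto simp: darts_multistar dart_vertex_multistar A_def)
  qed
  moreover have "finite (A \<union> B)" by (simp add: A_def B_def darts_at_multistar)
  ultimately have "card (orbit phi ` (A \<union> B)) = card (orbit (outer_perm lam f \<circ> c) ` A)"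
    using AB(2) by (rule card_orbits_bipartite) (use phiA phiB in auto)
  then show ?thesis unfolding faces_def AB(1) phi_def A_def .
qed

end

text \<open>Condition on the rotations at the outer vertices. With only the center random, the
  expectation is the integral for \<open>outer_perm\<close>, whose integrand depends on
  \<open>lam\<close> alone, so all conditions give the same value.\<close>

theorem expected_faces_multistar:
  assumes pos: "\<And>x. x \<in> set lam \<Longrightarrow> 0 < x" and ne: "lam \<noteq> []"
  shows "((\<lambda>t. (1 - (1 - t) * prod_list (map (cycle_factor t) lam)) / t) has_integral
    expected_faces (multistar lam)) {0..1}"
proof -
  let ?G = "multistar lam"
  define A where "A = darts_at ?G Center"
  define p where "p v = pmf_of_set (cyclic_perms (darts_at ?G v))" for v
  define V where "V = Outer ` {..<length lam}"
  define h where "h \<pi> = real (card (faces ?G \<pi>))" for \<pi>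
  define E where "E = measure_pmf.expectation (random_embedding ?G) h"
  have finA: "finite A" "A \<noteq> {}"
  proof -
    show "finite A" by (simp add: A_def darts_at_multistar)
    have "((0, 0), False) \<in> A" using ne pos[of "lam ! 0"] by (auto simp: A_def darts_at_multistar)
    then show "A \<noteq> {}" by auto
  qed
  have cyc: "finite (cyclic_perms A)" "cyclic_perms A \<noteq> {}"
    using finite_cyclic_perms cyclic_perms_nonempty finA by auto
  have outer: "finite (cyclic_perms (darts_at ?G (Outer i)))" "cyclic_perms (darts_at ?G (Outer i)) \<noteq> {}"
    if "i < length lam" for i
  proof -
    have "finite (darts_at ?G (Outer i))" "darts_at ?G (Outer i) \<noteq> {}"
      using that pos[of "lam ! i"] by (auto simp: darts_at_multistar)
    then show "finite (cyclic_perms (darts_at ?G (Outer i)))" "cyclic_perms (darts_at ?G (Outer i)) \<noteq> {}"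
      using finite_cyclic_perms cyclic_perms_nonempty by auto
  qed
  have finV: "finite V" "Center \<notin> V" unfolding V_def by auto
  have supp: "set_pmf (Pi_pmf V id p) = PiE_dflt V id (\<lambda>v. cyclic_perms (darts_at ?G v))"
    unfolding set_Pi_pmf[OF finV(1)] using outer
    by (auto simp: V_def p_def PiE_dflt_def)
  have fins: "finite (set_pmf (Pi_pmf V id p))"
    unfolding supp by (rule finite_PiE_dflt) (use finV outer in \<open>auto simp: V_def\<close>)
  have rot: "f (Outer i) \<in> cyclic_perms (darts_at ?G (Outer i))"
    if "f \<in> set_pmf (Pi_pmf V id p)" "i < length lam" for f i
    using that unfolding supp by (auto simp: PiE_dflt_def V_def)
  have integral: "((\<lambda>t. (1 - (1 - t) * prod_list (map (cycle_factor t) lam)) / t) has_integral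
      measure_pmf.expectation (p Center) (\<lambda>c. h (f(Center := c)))) {0..1}"
    if f: "f \<in> set_pmf (Pi_pmf V id p)" for f
  proof -
    note rot' = rot[OF f]
    have "(\<Sum>c\<in>cyclic_perms A. h (f(Center := c))) = long_cycle_orbits (outer_perm lam f) A"
      unfolding long_cycle_orbits_def h_def A_def
      using card_faces_multistar[OF pos rot'] by (intro sum.cong) auto
    then have "measure_pmf.expectation (p Center) (\<lambda>c. h (f(Center := c)))
        = long_cycle_orbits (outer_perm lam f) A / fact (card A - 1)"
      unfolding p_def A_def[symmetric] using cyc card_cyclic_perms[OF finA]
      by (simp add: integral_pmf_of_set)
    moreover have "perm_poly (outer_perm lam f) A t = prod_list (map (cycle_factor t) lam)" for t
      unfolding A_def by (rule perm_poly_outer_perm[OF pos rot'])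
    moreover have "outer_perm lam f permutes A"
      unfolding A_def by (rule outer_perm_permutes[OF pos rot'])
    ultimately show ?thesis
      using has_integral_long_cycle_orbits[OF finA, of "outer_perm lam f"] by simp
  qed
  obtain f0 where f0: "f0 \<in> set_pmf (Pi_pmf V id p)" using set_pmf_not_empty[of "Pi_pmf V id p"] by blast
  define E0 where "E0 = measure_pmf.expectation (p Center) (\<lambda>c. h (f0(Center := c)))"
  have const: "measure_pmf.expectation (p Center) (\<lambda>c. h (f(Center := c))) = E0"
    if "f \<in> set_pmf (Pi_pmf V id p)" for f
    unfolding E0_def using has_integral_unique[OF integral[OF that] integral[OF f0]] .
  have "random_embedding ?G = Pi_pmf (insert Center V) id p"
    by (simp add: random_embedding_def multistar_def V_def p_def[abs_def])
  also have "\<dots> = bind_pmf (p Center) (\<lambda>c. bind_pmf (Pi_pmf V id p) (\<lambda>f. return_pmf (f(Center := c))))"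
    by (rule Pi_pmf_insert'[OF finV])
  \<comment> \<open>Drawing the center last exhibits the expectation as an average of the
    conditional ones.\<close>
  also have "\<dots> = bind_pmf (Pi_pmf V id p) (\<lambda>f. bind_pmf (p Center) (\<lambda>c. return_pmf (f(Center := c))))"
    by (rule bind_commute_pmf)
  also have "\<dots> = bind_pmf (Pi_pmf V id p) (\<lambda>f. map_pmf (\<lambda>c. f(Center := c)) (p Center))"
    by (simp add: map_pmf_def)
  finally have emb: "random_embedding ?G
    = bind_pmf (Pi_pmf V id p) (\<lambda>f. map_pmf (\<lambda>c. f(Center := c)) (p Center))" .
  have fin0: "finite (set_pmf (p Center))"
    unfolding p_def A_def[symmetric] using cyc by simp
  have "E = (\<Sum>f\<in>set_pmf (Pi_pmf V id p). pmf (Pi_pmf V id p) f *\<^sub>R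
      measure_pmf.expectation (map_pmf (\<lambda>c. f(Center := c)) (p Center)) h)"
    unfolding E_def emb by (rule pmf_expectation_bind) (use fins fin0 in auto)
  also have "\<dots> = (\<Sum>f\<in>set_pmf (Pi_pmf V id p). pmf (Pi_pmf V id p) f * E0)"
    using const by (intro sum.cong) auto
  also have "\<dots> = E0"
    using sum_pmf_eq_1[OF fins] by (simp add: sum_distrib_right[symmetric])
  finally have "expected_faces ?G = E0"
    unfolding E_def expected_faces_def h_def[symmetric] .
  then show ?thesis using integral[OF f0] unfolding E0_def by simp
qed

section \<open>Estimating the integral\<close>

fun quad_moment :: "nat \<Rightarrow> real" where
  "quad_moment 0 = 1"
| "quad_moment (Suc k) = (1 + Suc k * quad_moment k) / (2 * k + 3)"

declare quad_moment.simps(2) [simp del]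

abbreviation quad :: "real \<Rightarrow> real" where
  "quad t \<equiv> (1 - t)\<^sup>2 + t\<^sup>2"

lemma quad_has_derivative:
  fixes t :: real
  shows "((\<lambda>t. quad t ^ Suc k) has_real_derivative - 2 * real (Suc k) * (1 - 2 * t) * quad t ^ k) (at t)"
  by (rule derivative_eq_intros refl | simp)+ (simp add: algebra_simps)

lemma has_integral_derivative:
  fixes f f' :: "real \<Rightarrow> real"
  assumes "\<And>t. (f has_real_derivative f' t) (at t)"
  shows "(f' has_integral (f 1 - f 0)) {0..1}"
  using assms
  by (intro fundamental_theorem_of_calculus)
     (simp_all add: has_real_derivative_iff_has_vector_derivative[symmetric] has_field_derivative_at_within)

text \<open>Since \<open>(1 - 2 * t)^2 = 2 * quad t - 1\<close>, the derivative of
  \<open>(1 - 2 * t) * quad t ^ Suc k\<close> combines just two consecutive powers, and it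
  integrates to -2. This is the origin of the recursion for \<open>quad_moment\<close>.\<close>

lemma has_integral_quad_power: "((\<lambda>t. quad t ^ k) has_integral quad_moment k) {0..1}"
proof (induct k)
  case 0
  show ?case using has_integral_const_real[of "1::real" 0 1] by simp
next
  case (Suc k)
  define F' where "F' t = 2 * real (Suc k) * quad t ^ k - (4 * real k + 6) * quad t ^ Suc k" for t :: real
  have "((\<lambda>t. (1 - 2 * t) * quad t ^ Suc k) has_real_derivative F' t) (at t)" for t
  proof -
    have "((\<lambda>t. 1 - 2 * t) has_real_derivative - 2) (at t)"
      by (auto intro!: derivative_eq_intros)
    from DERIV_mult[OF this quad_has_derivative[of k t]] show ?thesis
    proof (rule DERIV_cong)
      define Q where "Q = quad t ^ k"
      show "- 2 * quad t ^ Suc k + - 2 * real (Suc k) * (1 - 2 * t) * quad t ^ k * (1 - 2 * t) = F' t"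
        unfolding F'_def power_Suc Q_def[symmetric] by (simp add: power2_eq_square algebra_simps)
    qed
  qed
  from has_integral_derivative[OF this]
  have "(F' has_integral - 2) {0..1}" by simp
  from has_integral_mult_right[OF has_integral_diff[OF has_integral_mult_right[OF Suc, of "2 * Suc k"] this], of "1 / (4 * k + 6)"]
  have "((\<lambda>t. 1 / (4 * k + 6) * (2 * Suc k * quad t ^ k - F' t)) has_integral
      1 / (4 * k + 6) * (2 * Suc k * quad_moment k - - 2)) {0..1}" by simp
  moreover have "1 / (4 * k + 6) * (2 * Suc k * quad_moment k - - 2) = quad_moment (Suc k)"
    by (simp add: quad_moment.simps(2) field_simps)
  moreover have "1 / (4 * k + 6) * (2 * Suc k * quad t ^ k - F' t) = quad t ^ Suc k" for t
    unfolding F'_def by (simp add: add_pos_pos field_simps)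
  ultimately show ?case by simp
qed

text \<open>Substitute \<open>t * (1 - t) = (1 - quad t) / 2\<close> and
  \<open>(1 - t)^2 = (quad t + 1 - 2 * t) / 2\<close>. The terms with the factor
  \<open>1 - 2 * t\<close> are odd about 1/2 and integrate to 0.\<close>

lemma has_integral_cubic_quad_power:
  "((\<lambda>t. (1 - t) ^ 3 * t * quad t ^ j) has_integral
    (quad_moment (Suc j) - quad_moment (Suc (Suc j))) / 4) {0..1}"
proof -
  have odd: "((\<lambda>t. (1 - 2 * t) * quad t ^ i) has_integral 0) {0..1}" for i
  proof -
    have "((\<lambda>t. - 1 / (2 * Suc i) * quad t ^ Suc i) has_real_derivative (1 - 2 * t) * quad t ^ i) (at t)" for t :: real
      using DERIV_cmult[OF quad_has_derivative[of i t], of "- 1 / (2 * Suc i)"]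
      by (rule DERIV_cong) (simp add: field_simps)
    from has_integral_derivative[OF this] show ?thesis by simp
  qed
  note I = has_integral_quad_power
  have "((\<lambda>t. 1 / 4 * ((quad t ^ Suc j - quad t ^ Suc (Suc j))
      + ((1 - 2 * t) * quad t ^ j - (1 - 2 * t) * quad t ^ Suc j))) has_integral
      1 / 4 * ((quad_moment (Suc j) - quad_moment (Suc (Suc j))) + (0 - 0))) {0..1}"
    by (intro has_integral_mult_right has_integral_add has_integral_diff I odd)
  moreover have "1 / 4 * ((quad t ^ Suc j - quad t ^ Suc (Suc j))
      + ((1 - 2 * t) * quad t ^ j - (1 - 2 * t) * quad t ^ Suc j)) = (1 - t) ^ 3 * t * quad t ^ j" for t
  proof -
    define Q where "Q = quad t ^ j"
    show ?thesis unfolding power_Suc Q_def[symmetric]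
      by (simp add: power2_eq_square power3_eq_cube algebra_simps)
  qed
  ultimately show ?thesis by simp
qed

text \<open>The right-hand side is what the error estimate for \<open>m = 2 * k\<close> allows. At
  \<open>k = 2\<close> both sides are 7/5, so the strict inequality starts at 3.\<close>

lemma quad_moment_less:
  assumes "3 \<le> k"
  shows "(real k + 1) * quad_moment k < 1 + 4 * (real k - 1) / (real k * (2 * real k + 1))"
  using assms
proof (induct k rule: nat_induct_at_least)
  case base
  show ?case by (simp add: numeral_eq_Suc quad_moment.simps(2))
next
  case (Suc n)
  define k where "k = real n"
  have k: "3 \<le> k" using Suc unfolding k_def by simp
  define M where "M = quad_moment n"
  have IH: "(k + 1) * M < 1 + 4 * (k - 1) / (k * (2 * k + 1))"
    using Suc(2) unfolding k_def M_def by (simp add: algebra_simps)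
  \<comment> \<open>The recursion turns the bound
    \<open>1 + (3 * k - 1) / ((k + 1) * (k + 2))\<close> for \<open>k\<close> into the claim for
    \<open>k + 1\<close>. Comparing the hypothesis with it and clearing denominators gives
    this.\<close>
  have "4 * (k - 1) * ((k + 1) * (k + 2)) \<le> (3 * k - 1) * (k * (2 * k + 1))"
  proof -
    have "(3 * k - 1) * (k * (2 * k + 1)) - 4 * (k - 1) * ((k + 1) * (k + 2))
        = (k - 3) * (2 * k * k - k) + 8" 
      by (simp add: algebra_simps power2_eq_square)
    also have "\<dots> = (k - 3) * (k * (2 * k - 1)) + 8" by (simp add: algebra_simps)
    also have "\<dots> \<ge> 0" using k by (intro add_nonneg_nonneg mult_nonneg_nonneg) auto
    finally show ?thesis by simp
  qed
  then have "4 * (k - 1) / (k * (2 * k + 1)) \<le> (3 * k - 1) / ((k + 1) * (k + 2))"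
    using k by (simp add: frac_le_eq divide_nonpos_pos)
  with IH have "1 + (k + 1) * M < 2 + (3 * k - 1) / ((k + 1) * (k + 2))" by linarith
  also have "\<dots> = (2 * k + 3) / (k + 2) * (1 + 4 * k / ((k + 1) * (2 * k + 3)))"
    using k by (simp add: divide_simps) (simp add: algebra_simps)
  finally have "(k + 2) * ((1 + (k + 1) * M) / (2 * k + 3)) < 1 + 4 * k / ((k + 1) * (2 * k + 3))"
    using k by (simp add: field_simps)
  moreover have "quad_moment (Suc n) = (1 + (k + 1) * M) / (2 * k + 3)"
    unfolding k_def M_def by (simp add: quad_moment.simps(2) algebra_simps)
  ultimately show ?case unfolding k_def by (simp add: algebra_simps)
qed

text \<open>A rearranged recursion that reduces a difference of moments to the single moment bounded
  above.\<close>

lemma quad_moment_diff: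
  "real (Suc k) * (quad_moment k - quad_moment (Suc k)) = (real (Suc k) + 1) * quad_moment (Suc k) - 1"
  by (simp add: quad_moment.simps(2) field_simps)

section \<open>Products of power sums\<close>

context
  fixes x t :: real
  assumes x: "0 \<le> x" and t: "0 \<le> t"
begin

lemma even_powers_le: "x ^ (2 * Suc n) + t ^ (2 * Suc n) \<le> (x\<^sup>2 + t\<^sup>2) ^ Suc n"
proof (induct n)
  case (Suc n)
  define X T where "X = x ^ (2 * Suc n)" and "T = t ^ (2 * Suc n)"
  have XT: "0 \<le> X" "0 \<le> T" using x t unfolding X_def T_def by auto
  have "x ^ (2 * Suc (Suc n)) + t ^ (2 * Suc (Suc n)) = x\<^sup>2 * X + t\<^sup>2 * T"
    unfolding X_def T_def by (simp add: power2_eq_square algebra_simps)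
  also have "\<dots> \<le> (x\<^sup>2 + t\<^sup>2) * (X + T)"
    using XT by (simp add: algebra_simps)
  also have "\<dots> \<le> (x\<^sup>2 + t\<^sup>2) * (x\<^sup>2 + t\<^sup>2) ^ Suc n"
    using Suc unfolding X_def T_def by (intro mult_left_mono) auto
  finally show ?case by simp
qed simp

lemma odd_powers_le: "x ^ (2 * n + 3) + t ^ (2 * n + 3) \<le> (x ^ 3 + t ^ 3) * (x\<^sup>2 + t\<^sup>2) ^ n"
proof (induct n)
  case (Suc n)
  define X T where "X = x ^ (2 * n + 3)" and "T = t ^ (2 * n + 3)"
  have XT: "0 \<le> X" "0 \<le> T" using x t unfolding X_def T_def by auto
  have "2 * Suc n + 3 = 2 + (2 * n + 3)" by simp
  then have "x ^ (2 * Suc n + 3) + t ^ (2 * Suc n + 3) = x\<^sup>2 * X + t\<^sup>2 * T"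
    unfolding X_def T_def by (simp only: power_add)
  also have "\<dots> \<le> (x\<^sup>2 + t\<^sup>2) * (X + T)"
    using XT by (simp add: algebra_simps)
  also have "\<dots> \<le> (x\<^sup>2 + t\<^sup>2) * ((x ^ 3 + t ^ 3) * (x\<^sup>2 + t\<^sup>2) ^ n)"
    using Suc unfolding X_def T_def by (intro mult_left_mono) auto
  finally show ?case by (simp add: mult_ac)
qed simp

text \<open>The largest product of power sums over the partitions of \<open>m\<close> into parts of size at
  least 2: all parts are 2, except for a single 3 if \<open>m\<close> is odd.\<close>

definition max_product :: "nat \<Rightarrow> real" where
  "max_product m = (if even m then (x\<^sup>2 + t\<^sup>2) ^ (m div 2)
     else (x ^ 3 + t ^ 3) * (x\<^sup>2 + t\<^sup>2) ^ (m div 2 - 1))"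

lemma max_product_nonneg: "0 \<le> max_product m"
  using x t by (simp add: max_product_def)

lemma powers_le_max_product:
  assumes "2 \<le> l"
  shows "x ^ l + t ^ l \<le> max_product l"
proof (cases "even l")
  case True
  then obtain n where "l = 2 * Suc n" using assms by (metis Suc_pred evenE mult_0_right neq0_conv not_numeral_le_zero)
  then show ?thesis using even_powers_le[of n] by (simp add: max_product_def)
next
  case False
  then obtain n where l: "l = 2 * n + 3"
  proof -
    from False obtain i where "l = 2 * i + 1" by (auto elim: oddE)
    with assms that[of "i - 1"] show ?thesis by auto
  qed
  then show ?thesis using odd_powers_le[of n] by (simp add: max_product_def)
qed

text \<open>Concatenating two extremal partitions is extremal unless both contain a 3. In that case
  the two parts 3 are traded for three parts 2, by
  \<open>(x ^ 3 + t ^ 3)^2 \<le> (x^2 + t^2) ^ 3\<close>.\<close>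

lemma max_product_mult:
  assumes "2 \<le> a" "2 \<le> b"
  shows "max_product a * max_product b \<le> max_product (a + b)"
proof -
  define q where "q = x\<^sup>2 + t\<^sup>2"
  define c where "c = x ^ 3 + t ^ 3"
  have q: "0 \<le> q" unfolding q_def by simp
  have "q ^ 3 - c\<^sup>2 = x\<^sup>2 * t\<^sup>2 * (2 * x\<^sup>2 + 2 * t\<^sup>2 + (x - t)\<^sup>2)"
    unfolding q_def c_def by (simp add: power2_eq_square power3_eq_cube algebra_simps)
  also have "\<dots> \<ge> 0" by simp
  finally have cq: "c * c \<le> q ^ 3" by (simp add: power2_eq_square)
  have halve: "\<exists>i. l = 2 * Suc i \<or> l = 2 * Suc i + 1" if "2 \<le> l" for l :: nat
  proof -
    have "l = 2 * Suc (l div 2 - 1) \<or> l = 2 * Suc (l div 2 - 1) + 1" using that by presburger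
    then show ?thesis by blast
  qed
  obtain i j where i: "a = 2 * Suc i \<or> a = 2 * Suc i + 1" and j: "b = 2 * Suc j \<or> b = 2 * Suc j + 1"
    using halve[OF assms(1)] halve[OF assms(2)] by blast
  show ?thesis
  proof (cases "odd a \<and> odd b")
    case True
    then have ab: "a = 2 * Suc i + 1" "b = 2 * Suc j + 1" using i j by auto
    have "(c * q ^ i) * (c * q ^ j) = c * c * (q ^ i * q ^ j)" by simp
    also have "\<dots> \<le> q ^ 3 * (q ^ i * q ^ j)" using cq q by (intro mult_right_mono) auto
    also have "\<dots> = q ^ (i + j + 3)" by (simp add: power_add)
    finally show ?thesis
      unfolding max_product_def q_def[symmetric] c_def[symmetric] ab by (simp add: numeral_3_eq_3)
  next
    case False
    then consider "a = 2 * Suc i" "b = 2 * Suc j" | "a = 2 * Suc i + 1" "b = 2 * Suc j"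
      | "a = 2 * Suc i" "b = 2 * Suc j + 1" using i j by auto
    then show ?thesis
      by cases (simp_all add: max_product_def q_def[symmetric] c_def[symmetric] power_add mult_ac)
  qed
qed

lemma prod_list_powers_le:
  assumes "ls \<noteq> []" "\<And>l. l \<in> set ls \<Longrightarrow> 2 \<le> l"
  shows "prod_list (map (\<lambda>l. x ^ l + t ^ l) ls) \<le> max_product (sum_list ls)"
  using assms
proof (induct ls rule: list_nonempty_induct)
  case (single l)
  then show ?case using powers_le_max_product by simp
next
  case (cons l ls)
  have "2 \<le> sum_list ls" 
  proof -
    have "2 \<le> hd ls" using cons by simp
    also have "hd ls \<le> sum_list ls" using cons(1) by (cases ls) auto
    finally show ?thesis .
  qed
  have "prod_list (map (\<lambda>l. x ^ l + t ^ l) (l # ls)) \<le> max_product l * max_product (sum_list ls)"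
    using cons x t powers_le_max_product[of l] max_product_nonneg
    by (auto intro!: mult_mono prod_list_nonneg)
  also have "\<dots> \<le> max_product (sum_list (l # ls))"
    using max_product_mult[of l "sum_list ls"] cons \<open>2 \<le> sum_list ls\<close> by simp
  finally show ?case .
qed

text \<open>One more factor \<open>q = x^2 + t^2\<close> creates the new mixed terms
  \<open>x^2 * t^2 * (x ^ (2 * j + 2) + t ^ (2 * j + 2))\<close>, at most
  \<open>x^2 * t^2 * q ^ (j + 1)\<close>. So each step adds 1 to the constant, which is 2 at
  \<open>j = 0\<close>.\<close>

lemma even_max_product_diff:
  "(x\<^sup>2 + t\<^sup>2) ^ (j + 2) - x ^ (2 * j + 4) - t ^ (2 * j + 4) \<le> (real j + 2) * (x\<^sup>2 * t\<^sup>2 * (x\<^sup>2 + t\<^sup>2) ^ j)"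
proof (induct j)
  case 0
  show ?case by (simp add: power2_eq_square algebra_simps numeral_eq_Suc)
next
  case (Suc j)
  define q X T where "q = x\<^sup>2 + t\<^sup>2" and "X = x ^ (2 * Suc j)" and "T = t ^ (2 * Suc j)"
  have q: "0 \<le> q" unfolding q_def by simp
  have "q ^ (Suc j + 2) - x ^ (2 * Suc j + 4) - t ^ (2 * Suc j + 4)
      = q * (q ^ (j + 2) - x ^ (2 * j + 4) - t ^ (2 * j + 4)) + x\<^sup>2 * t\<^sup>2 * (X + T)"
    unfolding X_def T_def by (simp add: q_def power2_eq_square power_add algebra_simps numeral_eq_Suc)
  also have "\<dots> \<le> q * ((real j + 2) * (x\<^sup>2 * t\<^sup>2 * q ^ j)) + x\<^sup>2 * t\<^sup>2 * q ^ Suc j"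
    using Suc even_powers_le[of j] q unfolding q_def[symmetric] X_def T_def
    by (intro add_mono mult_left_mono) auto
  also have "\<dots> = (real (Suc j) + 2) * (x\<^sup>2 * t\<^sup>2 * q ^ Suc j)" by (simp add: algebra_simps)
  finally show ?case unfolding q_def .
qed

text \<open>As in the even case, but the initial difference is \<open>x^2 * t^2 * (x + t)\<close>,
  with constant 1. By \<open>x + t = 1\<close> both numbers are at most 1, so the odd powers in the
  step are bounded by even ones.\<close>

lemma odd_max_product_diff:
  assumes xt: "x + t = 1"
  shows "(x ^ 3 + t ^ 3) * (x\<^sup>2 + t\<^sup>2) ^ (j + 1) - x ^ (2 * j + 5) - t ^ (2 * j + 5)
    \<le> (real j + 1) * (x\<^sup>2 * t\<^sup>2 * (x\<^sup>2 + t\<^sup>2) ^ j)"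
proof (induct j)
  case 0
  have "(x ^ 3 + t ^ 3) * (x\<^sup>2 + t\<^sup>2) - x ^ 5 - t ^ 5 = x\<^sup>2 * t\<^sup>2 * (x + t)"
    by (simp add: power2_eq_square algebra_simps numeral_eq_Suc)
  then show ?case by (simp add: xt)
next
  case (Suc j)
  define q X T where "q = x\<^sup>2 + t\<^sup>2" and "X = x ^ (2 * j + 3)" and "T = t ^ (2 * j + 3)"
  have q: "0 \<le> q" unfolding q_def by simp
  have "X + T \<le> x ^ (2 * Suc j) + t ^ (2 * Suc j)"
    unfolding X_def T_def using x t xt by (intro add_mono power_decreasing) auto
  also have "\<dots> \<le> q ^ Suc j" using even_powers_le[of j] unfolding q_def .
  finally have XT: "X + T \<le> q ^ Suc j" .
  have "(x ^ 3 + t ^ 3) * q ^ (Suc j + 1) - x ^ (2 * Suc j + 5) - t ^ (2 * Suc j + 5)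
      = q * ((x ^ 3 + t ^ 3) * q ^ (j + 1) - x ^ (2 * j + 5) - t ^ (2 * j + 5)) + x\<^sup>2 * t\<^sup>2 * (X + T)"
    unfolding X_def T_def by (simp add: q_def power2_eq_square power_add algebra_simps numeral_eq_Suc)
  also have "\<dots> \<le> q * ((real j + 1) * (x\<^sup>2 * t\<^sup>2 * q ^ j)) + x\<^sup>2 * t\<^sup>2 * q ^ Suc j"
    using Suc XT q unfolding q_def[symmetric]
    by (intro add_mono mult_left_mono) auto
  also have "\<dots> = (real (Suc j) + 1) * (x\<^sup>2 * t\<^sup>2 * q ^ Suc j)" by (simp add: algebra_simps)
  finally show ?case unfolding q_def .
qed

end

section \<open>Comparison of the integrand with its two extreme terms\<close>

definition part_sign :: "nat list \<Rightarrow> real" where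
  "part_sign ls = prod_list (map (\<lambda>l. - ((- 1) ^ l)) ls)"

lemma abs_part_sign: "\<bar>part_sign ls\<bar> = 1"
  by (induct ls) (auto simp: part_sign_def abs_mult power_abs)

lemma part_sign_cases: "part_sign ls = 1 \<or> part_sign ls = - 1"
  using abs_part_sign[of ls] by linarith

text \<open>Each factor is \<open>(1 - t) ^ l\<close> plus a signed \<open>t ^ l\<close>. Multiplied
  out, the two products have the same monomials up to sign. The pure power of \<open>t\<close>
  carries \<open>part_sign ls\<close>, and the triangle inequality compares everything but the two
  pure powers.\<close>

lemma prod_cycle_factor_remainder:
  assumes t: "0 \<le> t" "t \<le> 1" and ne: "ls \<noteq> []"
  shows "\<bar>prod_list (map (cycle_factor t) ls) - (1 - t) ^ sum_list ls - part_sign ls * t ^ sum_list ls\<bar>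
    \<le> prod_list (map (\<lambda>l. (1 - t) ^ l + t ^ l) ls) - (1 - t) ^ sum_list ls - t ^ sum_list ls"
  using ne
proof (induct ls rule: list_nonempty_induct)
  case (single l)
  show ?case by (simp add: part_sign_def cycle_factor_def power_minus[of t])
next
  case (cons l ls)
  define a b e where "a = (1 - t) ^ l" and "b = t ^ l" and "e = - ((- 1) ^ l :: real)"
  define X Y E F M where "X = (1 - t) ^ sum_list ls" and "Y = t ^ sum_list ls"
    and "E = part_sign ls" and "F = prod_list (map (cycle_factor t) ls)"
    and "M = prod_list (map (\<lambda>l. (1 - t) ^ l + t ^ l) ls)"
  have nn: "0 \<le> a" "0 \<le> b" "0 \<le> X" "0 \<le> Y" using t unfolding a_def b_def X_def Y_def by auto
  have e: "\<bar>e\<bar> = 1" unfolding e_def by (simp add: power_abs)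
  have E: "\<bar>E\<bar> = 1" unfolding E_def by (rule abs_part_sign)
  define R where "R = F - X - E * Y"
  have R: "\<bar>R\<bar> \<le> M - X - Y" using cons unfolding R_def F_def X_def E_def Y_def M_def by simp
  have "cycle_factor t l = a + e * b"
    by (simp add: cycle_factor_def a_def b_def e_def power_minus[of t])
  then have "prod_list (map (cycle_factor t) (l # ls)) - (1 - t) ^ sum_list (l # ls) - part_sign (l # ls) * t ^ sum_list (l # ls)
      = (a + e * b) * F - a * X - e * E * (b * Y)"
    by (simp add: F_def part_sign_def E_def a_def b_def e_def X_def Y_def power_add)
  \<comment> \<open>The two mixed products of pure powers, and the old remainder times the new
    factor.\<close>
  also have "\<dots> = E * (a * Y) + e * (b * X) + (a + e * b) * R"
    by (simp add: R_def algebra_simps)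
  also have "\<bar>\<dots>\<bar> \<le> a * Y + b * X + (a + b) * (M - X - Y)"
  proof -
    have "\<bar>E * (a * Y)\<bar> = a * Y" "\<bar>e * (b * X)\<bar> = b * X" using e E nn by (simp_all add: abs_mult)
    moreover have "\<bar>(a + e * b) * R\<bar> \<le> (a + b) * (M - X - Y)"
    proof -
      have "\<bar>a + e * b\<bar> \<le> \<bar>a\<bar> + \<bar>e * b\<bar>" by (rule abs_triangle_ineq)
      also have "\<dots> = a + b" using e nn by (simp add: abs_mult)
      finally show ?thesis unfolding abs_mult using R nn by (intro mult_mono) auto
    qed
    ultimately show ?thesis by linarith
  qed
  also have "\<dots> = prod_list (map (\<lambda>l. (1 - t) ^ l + t ^ l) (l # ls))
      - (1 - t) ^ sum_list (l # ls) - t ^ sum_list (l # ls)"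
    by (simp add: M_def a_def b_def X_def Y_def power_add algebra_simps)
  finally show ?case .
qed

lemma has_integral_power_complement: "((\<lambda>t::real. (1 - t) ^ i) has_integral 1 / (real i + 1)) {0..1}"
proof -
  have "((\<lambda>t::real. - ((1 - t) ^ Suc i) / (real i + 1)) has_real_derivative (1 - t) ^ i) (at t)" for t
    by (rule derivative_eq_intros refl | simp)+ (simp add: field_simps)
  from has_integral_derivative[OF this] show ?thesis by simp
qed

text \<open>The power of \<open>1 - t\<close> leaves a geometric sum, which integrates to a harmonic
  number; the power of \<open>t\<close> leaves the beta integral of
  \<open>(1 - t) * t ^ (m - 1)\<close>.\<close>

lemma has_integral_leading_terms:
  assumes m: "0 < m"
  shows "((\<lambda>t. (1 - (1 - t) * ((1 - t) ^ m + e * t ^ m)) / t) has_integral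
    harm (m + 1) - e / (real m * (real m + 1))) {0..1}"
proof -
  have "((\<lambda>t::real. \<Sum>i<m + 1. (1 - t) ^ i) has_integral (\<Sum>i<m + 1. 1 / (real i + 1))) {0..1}"
    by (intro has_integral_sum has_integral_power_complement) simp
  moreover have "(\<Sum>i<m + 1. 1 / (real i + 1)) = harm (m + 1)"
    unfolding harm_altdef by (intro sum.cong) (auto simp: field_simps)
  moreover have "((\<lambda>t. (1 - t) * t ^ (m - 1)) has_integral 1 / (real m * (real m + 1))) {0..1}"
  proof -
    obtain k where k: "m = Suc k" using m by (cases m) auto
    have pow: "((\<lambda>t. t ^ Suc n / (real n + 1)) has_real_derivative t ^ n) (at t)" for n and t :: real
      by (rule derivative_eq_intros refl | simp)+ (simp add: add_pos_nonneg field_simps)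
    have "((\<lambda>t. t ^ Suc k / (real k + 1) - t ^ Suc (Suc k) / (real (Suc k) + 1)) has_real_derivative
        (1 - t) * t ^ k) (at t)" for t
      using DERIV_diff[OF pow[of k t] pow[of "Suc k" t]] by (rule DERIV_cong) (simp add: algebra_simps)
    from has_integral_derivative[OF this] show ?thesis unfolding k by (simp add: field_simps)
  qed
  ultimately have "((\<lambda>t. (\<Sum>i<m + 1. (1 - t) ^ i) - e * ((1 - t) * t ^ (m - 1))) has_integral
      harm (m + 1) - e * (1 / (real m * (real m + 1)))) {0..1}"
    by (intro has_integral_diff has_integral_mult_right) auto
  then have total: "((\<lambda>t. (\<Sum>i<m + 1. (1 - t) ^ i) - e * ((1 - t) * t ^ (m - 1))) has_integral
      harm (m + 1) - e / (real m * (real m + 1))) {0..1}"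
    by simp
  have eq: "(1 - (1 - t) * ((1 - t) ^ m + e * t ^ m)) / t
      = (\<Sum>i<m + 1. (1 - t) ^ i) - e * ((1 - t) * t ^ (m - 1))" if "t \<noteq> 0" for t
  proof -
    have "1 - (1 - t) ^ (m + 1) = t * (\<Sum>i<m + 1. (1 - t) ^ i)"
      using one_diff_power_eq[of "1 - t" "m + 1"] by simp
    moreover have "t ^ m = t * t ^ (m - 1)" using m by (cases m) auto
    ultimately have "1 - (1 - t) * ((1 - t) ^ m + e * t ^ m)
        = t * ((\<Sum>i<m + 1. (1 - t) ^ i) - e * ((1 - t) * t ^ (m - 1)))"
      by (simp add: algebra_simps)
    then show ?thesis by (simp only: nonzero_mult_div_cancel_left[OF that])
  qed
  show ?thesis
    by (rule has_integral_spike_finite[OF _ _ total, of "{0}"]) (use eq in auto)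
qed

text \<open>Where \<open>harm (m + 1)\<close> has \<open>1 / m + 1 / (m + 1)\<close>,
  \<open>Delta m\<close> has \<open>2 / m\<close> for even \<open>m\<close> and
  \<open>2 / (m + 1)\<close> for odd \<open>m\<close>. These differ by
  \<open>1 / (m * (m + 1))\<close>, with a sign given by the parity.\<close>

lemma Delta_eq:
  assumes "0 < m"
  shows "harm (m + 1) - e / (real m * (real m + 1)) - Delta m
    = (if even m then - (1 + e) else 1 - e) / (real m * (real m + 1))"
proof -
  obtain i where i: "m = Suc i" using assms by (cases m) auto
  have ab: "1 / real m = (real m + 1) / (real m * (real m + 1))" "1 / (real m + 1) = real m / (real m * (real m + 1))"
  proof -
    have "real m \<noteq> 0" "real m + 1 \<noteq> 0" "real m * (real m + 1) \<noteq> 0" using assms by auto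
    then show "1 / real m = (real m + 1) / (real m * (real m + 1))" "1 / (real m + 1) = real m / (real m * (real m + 1))"
      unfolding frac_eq_eq[OF \<open>real m \<noteq> 0\<close> \<open>real m * (real m + 1) \<noteq> 0\<close>]
        frac_eq_eq[OF \<open>real m + 1 \<noteq> 0\<close> \<open>real m * (real m + 1) \<noteq> 0\<close>]
      by (simp_all add: algebra_simps)
  qed
  have H: "harm (m + 1) = harm (m - 1) + 1 / real m + 1 / (real m + 1)"
    unfolding i by (simp add: harm_Suc field_simps)
  show ?thesis
  proof (cases "even m")
    case True
    then obtain k where k: "m = 2 * k" by auto
    then have "0 < k" using assms by simp
    have "\<lceil>real m / 2\<rceil> = int k" unfolding k by simp
    then have "Delta m = harm (m - 1) + 1 / real k" by (simp add: Delta_def field_simps)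
    then have "harm (m + 1) - e / (real m * (real m + 1)) - Delta m
        = 1 / (real m + 1) - 1 / real m - e / (real m * (real m + 1))"
      unfolding H by (simp add: k)
    also have "\<dots> = - (1 + e) / (real m * (real m + 1))"
      unfolding ab diff_divide_distrib[symmetric] by (rule arg_cong2[where f = "(/)"]) auto
    finally show ?thesis by (simp only: True if_True)
  next
    case False
    then obtain k where k: "m = 2 * k + 1" by (auto elim: oddE)
    have "\<lceil>real m / 2\<rceil> = int k + 1" unfolding k by (simp add: ceiling_eq_iff field_simps)
    then have "Delta m = harm (m - 1) + 1 / (real k + 1)" by (simp add: Delta_def field_simps)
    then have "harm (m + 1) - e / (real m * (real m + 1)) - Delta m
        = 1 / real m - 1 / (real m + 1) - e / (real m * (real m + 1))"
    proof -
      have "1 / (real k + 1) = 2 * (1 / (real m + 1))" by (simp add: k field_simps)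
      with \<open>Delta m = _\<close> show ?thesis unfolding H by simp
    qed
    also have "\<dots> = (1 - e) / (real m * (real m + 1))"
      unfolding ab diff_divide_distrib[symmetric] by (rule arg_cong2[where f = "(/)"]) auto
    finally show ?thesis by (simp only: False if_False)
  qed
qed

text \<open>The right-hand side is \<open>1 / (m + 1)\<close> less the
  \<open>2 / (m * (m + 1))\<close> that the extreme terms may cost. Even \<open>m\<close> is
  \<open>quad_moment_less\<close> at \<open>m div 2\<close>; for odd \<open>m\<close> the smaller
  constant leaves room.\<close>

lemma quad_moment_diff_bound:
  assumes m: "5 \<le> m" and j: "m div 2 = j + 2"
  shows "(if even m then real j + 2 else real j + 1)
      * ((quad_moment (Suc j) - quad_moment (Suc (Suc j))) / 4) < (real m - 2) / (real m * (real m + 1))"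
proof -
  define k where "k = real j + 2"
  define D where "D = quad_moment (Suc j) - quad_moment (Suc (Suc j))"
  have k: "2 \<le> k" unfolding k_def by simp
  have kD: "k * D = (k + 1) * quad_moment (j + 2) - 1"
    using quad_moment_diff[of "Suc j"] by (simp add: k_def D_def add_ac)
  have strict: "k * D < 4 * (k - 1) / (k * (2 * k + 1))" if "0 < j"
  proof -
    have "3 \<le> j + 2" and kj: "real (j + 2) = k" using that by (simp_all add: k_def)
    from quad_moment_less[OF this(1), unfolded kj] show ?thesis unfolding kD by linarith
  qed
  show ?thesis
  proof (cases "even m")
    case True
    then have mj: "m = 2 * (j + 2)" using j by auto
    then have "real m = 2 * k" unfolding k_def by simp
    moreover have "k * D / 4 < (k - 1) / (k * (2 * k + 1))" using strict m mj by (simp add: mult.commute)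
    moreover have "(2 * k - 2) / (2 * k * (2 * k + 1)) = (k - 1) / (k * (2 * k + 1))"
      using k by (simp add: divide_simps) (simp add: algebra_simps)
    ultimately have "k * (D / 4) < (real m - 2) / (real m * (real m + 1))" by simp
    then show ?thesis using True unfolding k_def D_def by simp
  next
    case False
    then have mk: "real m = 2 * k + 1" using j unfolding k_def by (auto elim!: oddE)
    \<comment> \<open>At \<open>k = 2\<close> both sides are 2/5; strictness comes from the
      polynomial inequality below.\<close>
    have "k * D \<le> 4 * (k - 1) / (k * (2 * k + 1))"
    proof (cases "j = 0")
      case True
      then show ?thesis by (simp add: k_def D_def quad_moment.simps(2))
    next
      case False
      then show ?thesis using strict by simp
    qed
    then have "D \<le> 4 * (k - 1) / (k * (2 * k + 1)) / k"
      using k by (simp add: pos_le_divide_eq mult.commute)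
    then have "D / 4 \<le> (k - 1) / (k * (2 * k + 1)) / k"
      by (simp add: mult.commute)
    then have "(k - 1) * (D / 4) \<le> (k - 1) * ((k - 1) / (k * (2 * k + 1)) / k)"
      using k by (intro mult_left_mono) auto
    also have "\<dots> < (2 * k - 1) / ((2 * k + 1) * (2 * k + 2))"
    proof -
      have "(2 * k - 1) * (k * k) - (k - 1) * (k - 1) * (2 * k + 2) = k * k + 2 * (k - 1)"
        by (simp add: algebra_simps)
      also have "\<dots> > 0" using k by (smt (verit) mult_pos_pos)
      finally have "(k - 1) * (k - 1) * (2 * k + 2) < (2 * k - 1) * (k * k)" by simp
      then have "(k - 1) * (k - 1) / (k * k) < (2 * k - 1) / (2 * k + 2)"
        using k by (simp add: divide_simps)
      then have "(k - 1) * (k - 1) / (k * k) / (2 * k + 1) < (2 * k - 1) / (2 * k + 2) / (2 * k + 1)"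
        using k by (intro divide_strict_right_mono) auto
      then show ?thesis by (simp add: mult_ac)
    qed
    finally have "(k - 1) * (D / 4) < (real m - 2) / (real m * (real m + 1))" unfolding mk by (simp add: add.commute)
    moreover have "k - 1 = real j + 1" by (simp add: k_def)
    ultimately show ?thesis using False unfolding D_def by simp
  qed
qed

lemma integral_near_Delta:
  assumes ge2: "\<And>l. l \<in> set ls \<Longrightarrow> 2 \<le> l" and ne: "ls \<noteq> []"
    and int: "((\<lambda>t. (1 - (1 - t) * prod_list (map (cycle_factor t) ls)) / t) has_integral E) {0..1}"
  defines "m \<equiv> sum_list ls"
  shows "\<bar>E - Delta m\<bar> < 1 / (real m + 1)"
proof -
  define e where "e = part_sign ls"
  define D0 where "D0 = harm (m + 1) - e / (real m * (real m + 1))"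
  obtain l ls' where ls: "ls = l # ls'" using ne by (cases ls) auto
  have l2: "2 \<le> l" using ge2 ls by simp
  then have m2: "2 \<le> m" unfolding m_def ls by simp
  have lead: "((\<lambda>t. (1 - (1 - t) * ((1 - t) ^ m + e * t ^ m)) / t) has_integral D0) {0..1}"
    unfolding D0_def using m2 by (intro has_integral_leading_terms) simp
  have D: "D0 - Delta m = (if even m then - (1 + e) else 1 - e) / (real m * (real m + 1))"
    unfolding D0_def using m2 by (intro Delta_eq) simp
  have e: "e = 1 \<or> e = - 1" unfolding e_def by (rule part_sign_cases)
  show ?thesis
  proof (cases ls')
    case Nil
    then have m: "m = l" and e': "e = - ((- 1) ^ m)" unfolding e_def m_def ls part_sign_def by auto
    have "prod_list (map (cycle_factor t) ls) = (1 - t) ^ m + e * t ^ m" for t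
      unfolding ls Nil e' m by (simp add: cycle_factor_def power_minus[of t])
    then have "E = D0" using has_integral_unique[OF int] lead by simp
    \<comment> \<open>With this sign the numerator in \<open>Delta_eq\<close> vanishes for either
      parity, so a single part gives \<open>Delta m\<close> exactly.\<close>
    moreover have "D0 - Delta m = 0" unfolding D e' by simp
    ultimately show ?thesis by simp
  next
    case (Cons l' ls'')
    have l'2: "2 \<le> l'" using ge2 ls Cons by simp
    have m4: "m = l + l' + sum_list ls''" unfolding m_def ls Cons by simp
    txt \<open>For \<open>m = 4\<close> the general estimate below only gives a non-strict inequality.\<close>
    show ?thesis
    proof (cases "m = 4")
      case True
      have "ls'' = []"
      proof (cases ls'')
        case (Cons a as)
        then have "2 \<le> a" using ge2 ls \<open>ls' = l' # ls''\<close> by simp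
        then show ?thesis using True m4 l2 l'2 Cons by simp
      qed simp
      \<comment> \<open>The only case with sum 4 and at least two parts; here \<open>E\<close> turns
        out to equal \<open>Delta 4\<close>.\<close>
      then have "ls = [2, 2]" using True m4 l2 l'2 ls Cons by simp
      then have F: "prod_list (map (cycle_factor t) ls) = (1 - 2 * t)\<^sup>2" for t
        by (simp add: cycle_factor_def power2_eq_square algebra_simps)
      have "((\<lambda>t::real. 5 - 8 * t + 4 * t\<^sup>2) has_integral (7 / 3 - 0)) {0..1}"
      proof -
        have "((\<lambda>t::real. 5 * t - 4 * t\<^sup>2 + 4 / 3 * t ^ 3) has_real_derivative 5 - 8 * t + 4 * t\<^sup>2) (at t)" for t
          by (rule derivative_eq_intros refl | simp)+
        from has_integral_derivative[OF this] show ?thesis by simp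
      qed
      then have "((\<lambda>t. (1 - (1 - t) * prod_list (map (cycle_factor t) ls)) / t) has_integral (7 / 3 - 0)) {0..1}"
        by (rule has_integral_spike_finite[of "{0}", rotated 2])
           (auto simp: F power2_eq_square field_simps)
      then have "E = 7 / 3" using has_integral_unique[OF int] by simp
      moreover have "Delta 4 = 7 / 3" by (simp add: Delta_def harm_expand)
      ultimately show ?thesis using True by simp
    next
      case False
      then have m5: "5 \<le> m" using m4 l2 l'2 by simp
      define j where "j = m div 2 - 2"
      have j: "m div 2 = j + 2" using m5 unfolding j_def by simp
      define c where "c = (if even m then real j + 2 else real j + 1)"
      define B where "B = c * ((quad_moment (Suc j) - quad_moment (Suc (Suc j))) / 4)"
      have B: "B < (real m - 2) / (real m * (real m + 1))"
        unfolding B_def c_def by (rule quad_moment_diff_bound[OF m5 j])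
      \<comment> \<open>For nonzero \<open>t\<close> this difference is \<open>(1 - t) / t\<close>
        times the remainder, which turns the bound with \<open>(1 - t)^2 * t^2\<close> into one with
        \<open>(1 - t) ^ 3 * t\<close>.\<close>
      define g where "g t = (1 - (1 - t) * ((1 - t) ^ m + e * t ^ m)) / t
        - (1 - (1 - t) * prod_list (map (cycle_factor t) ls)) / t" for t
      have gi: "(g has_integral (D0 - E)) {0..1}"
        unfolding g_def by (rule has_integral_diff[OF lead int])
      have bi: "((\<lambda>t. c * ((1 - t) ^ 3 * t * quad t ^ j)) has_integral B) {0..1}"
        unfolding B_def by (intro has_integral_mult_right has_integral_cubic_quad_power)
      have bound: "\<bar>g t\<bar> \<le> c * ((1 - t) ^ 3 * t * quad t ^ j)" if t: "t \<in> {0..1}" for t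
      proof (cases "t = 0")
        case True
        then show ?thesis by (simp add: g_def)
      next
        case False
        with t have t: "0 < t" "t \<le> 1" by auto
        define R where "R = prod_list (map (cycle_factor t) ls) - (1 - t) ^ m - e * t ^ m"
        have "\<bar>R\<bar> \<le> prod_list (map (\<lambda>l. (1 - t) ^ l + t ^ l) ls) - (1 - t) ^ m - t ^ m"
          unfolding R_def m_def e_def by (rule prod_cycle_factor_remainder) (use t ne in auto)
        also have "prod_list (map (\<lambda>l. (1 - t) ^ l + t ^ l) ls) \<le> max_product (1 - t) t m"
          unfolding m_def by (rule prod_list_powers_le) (use t ne ge2 in auto)
        also have "max_product (1 - t) t m - (1 - t) ^ m - t ^ m \<le> c * ((1 - t)\<^sup>2 * t\<^sup>2 * quad t ^ j)"
        proof (cases "even m")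
          case True
          then have "m = 2 * j + 4" using j by auto
          then show ?thesis using even_max_product_diff[of "1 - t" t j] t True
            by (simp add: max_product_def c_def)
        next
          case False
          then have "m = 2 * j + 5" using j by (auto elim!: oddE)
          then show ?thesis using odd_max_product_diff[of "1 - t" t j] t False
            by (simp add: max_product_def c_def)
        qed
        finally have R: "\<bar>R\<bar> \<le> c * ((1 - t)\<^sup>2 * t\<^sup>2 * quad t ^ j)" by simp
        have "g t = (1 - t) * R / t"
          unfolding g_def R_def by (simp add: diff_divide_distrib[symmetric] algebra_simps)
        then have "\<bar>g t\<bar> = (1 - t) / t * \<bar>R\<bar>" using t by (simp add: abs_mult)
        also have "\<dots> \<le> (1 - t) / t * (c * ((1 - t)\<^sup>2 * t\<^sup>2 * quad t ^ j))"
          using R t by (intro mult_left_mono) auto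
        also have "\<dots> = c * ((1 - t) ^ 3 * t * quad t ^ j)"
          using t by (simp add: power2_eq_square power3_eq_cube)
        finally show ?thesis .
      qed
      have "D0 - E \<le> B"
        by (rule has_integral_le[OF gi bi]) (use bound abs_le_D1 in blast)
      moreover have "- (D0 - E) \<le> B"
        by (rule has_integral_le[OF has_integral_neg[OF gi] bi]) (use bound abs_le_D2 in blast)
      moreover have "\<bar>D0 - Delta m\<bar> \<le> 2 / (real m * (real m + 1))"
        unfolding D using e by (auto simp: abs_if)
      moreover have "(real m - 2) / (real m * (real m + 1)) + 2 / (real m * (real m + 1)) = 1 / (real m + 1)"
        using m5 by (simp add: add_divide_distrib[symmetric])
      ultimately show ?thesis using B by linarith
    qed
  qed
qed

theorem theorem4:
  fixes lam :: "nat list" and n n' :: nat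
  assumes "number_partition lam n"
    and "\<exists>x\<in>set lam. 2 \<le> x"
    and "n' = n - count_list lam 1"
  shows "expected_faces (multistar lam)
           \<in> {Delta n' - 1 / (real n' + 1) <..< Delta n' + 1 / (real n' + 1)}"
proof -
  \<comment> \<open>Parts of size 1 have factor 1, so \<open>mu\<close> has the same integrand, and
    its sum is \<open>n'\<close>.\<close>
  define mu where "mu = filter (\<lambda>l. l \<noteq> 1) lam"
  have pos: "0 < x" if "x \<in> set lam" for x
    using assms(1) that unfolding number_partition_def by auto
  have n: "sum_list lam = n" using assms(1) unfolding number_partition_def by simp
  have ne: "lam \<noteq> []" "mu \<noteq> []" using assms(2) unfolding mu_def by (force simp: filter_empty_conv)+
  have ge2: "2 \<le> l" if "l \<in> set mu" for l
    using that pos[of l] unfolding mu_def by auto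
  have "sum_list xs = sum_list (filter (\<lambda>l. l \<noteq> 1) xs) + count_list xs 1" for xs :: "nat list"
    by (induct xs) auto
  then have n': "n' = sum_list mu" using assms(3) n unfolding mu_def by (metis add_diff_cancel_right')
  have "prod_list (map (cycle_factor t) xs) = prod_list (map (cycle_factor t) (filter (\<lambda>l. l \<noteq> 1) xs))"
    for t xs by (induct xs) auto
  then have "((\<lambda>t. (1 - (1 - t) * prod_list (map (cycle_factor t) mu)) / t) has_integral
      expected_faces (multistar lam)) {0..1}"
    using expected_faces_multistar[OF pos ne(1)] unfolding mu_def by simp
  from integral_near_Delta[OF ge2 ne(2) this] show ?thesis
    unfolding n' by (auto simp: abs_less_iff)
qed

end
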